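(* Let $\mathscr G$ be an ample groupoid and $\mathcal O$ a $\mathscr G$-sheaf of commutative rings. If $\Gamma_c(\mathscr G^{(0)},\mathcal O)$ is a maximal commutative subring of $\Gamma_c(\mathscr G,\mathcal O)$, then $\mathrm{Int}(\ker\mathcal O)=\mathscr G^{(0)}$. If moreover $\mathcal O$ is a $\mathscr G$-sheaf of integral domains and $\Gamma_c(\mathrm{Int}(\ker\mathcal O),\mathcal O)=\{f\in\Gamma_c(\mathscr G,\mathcal O)\mid \mathrm{supp}(f)\subseteq\ker\mathcal O\}$, then the converse is also true.
   Context: "Compact" includes Hausdorff. A groupoid $\mathscr G$ (identified with its set of arrows) has unit space $\mathscr G^{(0)}$, $\boldsymbol d(\gamma)=\gamma^{-1}\gamma$, $\boldsymbol r(\gamma)=\gamma\gamma^{-1}$. It is ample if it is a topological groupoid such that $\mathscr G^{(0)}$ is locally compact Hausdorff with a basis of compact open sets and $\boldsymbol r$ is a local homeomorphism ($\mathscr G$ itself need not be Hausdorff). A bisection is a subset on which $\boldsymbol d$ and $\boldsymbol r$ are injective. $\mathrm{Iso}(\mathscr G)=\{g\in\mathscr G:\boldsymbol d(g)=\boldsymbol r(g)\}$. $\mathrm{Int}$ denotes topological interior in $\mathscr G$. A $\mathscr G$-sheaf $(E,p,\alpha)$ is a space $E$, a local homeomorphism $p:E\to\mathscr G^{(0)}$ and a continuous map $\alpha:\mathscr G\times_{\boldsymbol d,p}E\to E$, $(\gamma,e)\mapsto\alpha_\gamma(e)$, with $\alpha_{p(e)}(e)=e$, $p(\alpha_\gamma(e))=\boldsymbol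 r(\gamma)$, and $\alpha_\beta(\alpha_\gamma(e))=\alpha_{\beta\gamma}(e)$ whenever defined. The stalk at $x$ is $p^{-1}(x)$. A $\mathscr G$-sheaf of rings $\mathcal O=(E,p,\alpha)$ is a $\mathscr G$-sheaf with a unital ring structure (with $1_x\ne 0_x$) on each stalk $\mathcal O_x$ such that fiberwise addition and multiplication $E\times_{p,p}E\to E$ and the unit section $x\mapsto 1_x$ are continuous, and each $\alpha_\gamma:\mathcal O_{\boldsymbol d(\gamma)}\to\mathcal O_{\boldsymbol r(\gamma)}$ is a (unital) ring homomorphism. It is a sheaf of commutative rings (integral domains) if every stalk is a commutative ring (integral domain). $\Gamma_c(\mathscr G,\mathcal O)$ is the additive group generated by all maps $f:\mathscr G\to E$ with $p\circ f=\boldsymbol r$ for which there is a compact open bisection $U$ with $f|_U$ continuous and $f=0$ off $U$. It is a ring under pointwise addition and convolution $(f*g)(\gamma)=\sum_{\beta\rho=\gamma}f(\beta)\alpha_\beta(g(\rho))$. $\mathrm{supp}(f)=\{\gamma: f(\gamma)\neq 0\}$. $\Gamma_c(\mathscr G^{(0)},\mathcal O)$ is the ring of compactly supported continuous sections $\mathscr G^{(0)}\to E$ of $p$ with pointwise operations, viewed as a subring of $\Gamma_c(\mathscr G,\mathcal O)$ by extending by zero. $\ker\mathcal O=\{\gamma\in\mathrm{Iso}(\mathscr G)\mid\alpha_\gamma(a)=a\ \text{for all } a\in\mathcal O_{\boldsymbol d(\gamma)}\}$. $\mathrm{Int}(\ker\mathcal O)$ is an ample subgroupoid, and $\Gamma_c(\mathrm{Int}(\ker\mathcal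 O),\mathcal O)$ is identified with the additive subgroup of $\Gamma_c(\mathscr G,\mathcal O)$ generated by all maps $f:\mathscr G\to E$ with $p\circ f=\boldsymbol r$ for which there is a compact open bisection $U\subseteq\mathrm{Int}(\ker\mathcal O)$ with $f|_U$ continuous and $f=0$ off $U$. *)

theory Defs
  imports "HOL-Analysis.Analysis" "HOL-Algebra.Ring" "HOL-Algebra.Product_Groups"
begin

section \<open>Topological preliminaries\<close>

definition compact_Hausdorff_in :: "'a topology \<Rightarrow> 'a set \<Rightarrow> bool" where
  "compact_Hausdorff_in X K \<longleftrightarrow> compactin X K \<and> Hausdorff_space (subtopology X K)"

definition local_homeo :: "'a topology \<Rightarrow> 'b topology \<Rightarrow> ('a \<Rightarrow> 'b) \<Rightarrow> bool" where
  "local_homeo X Y f \<longleftrightarrow>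
     (\<forall>x\<in>topspace X. \<exists>U. openin X U \<and> x \<in> U \<and> openin Y (f ` U) \<and>
        homeomorphic_map (subtopology X U) (subtopology Y (f ` U)) f)"

definition has_compact_open_basis :: "'a topology \<Rightarrow> bool" where
  "has_compact_open_basis X \<longleftrightarrow>
     openin X = arbitrary union_of (\<lambda>K. openin X K \<and> compact_Hausdorff_in X K)"


section \<open>Ample groupoids\<close>

text \<open>A groupoid is given by its arrows, which carry a topology; the units are particular arrows,
  and source and range are derived from composition and inversion. The product \<open>gmult \<G> \<beta> \<gamma>\<close> is
  meaningful only if \<open>src \<G> \<beta> = rng \<G> \<gamma>\<close>.\<close>

record 'g top_groupoid =
  gtop :: "'g topology"
  gmult :: "'g \<Rightarrow> 'g \<Rightarrow> 'g"
  ginv :: "'g \<Rightarrow> 'g"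

abbreviation arrows :: "'g top_groupoid \<Rightarrow> 'g set" where
  "arrows \<G> \<equiv> topspace (gtop \<G>)"

definition src :: "'g top_groupoid \<Rightarrow> 'g \<Rightarrow> 'g" where
  "src \<G> \<gamma> = gmult \<G> (ginv \<G> \<gamma>) \<gamma>"

definition rng :: "'g top_groupoid \<Rightarrow> 'g \<Rightarrow> 'g" where
  "rng \<G> \<gamma> = gmult \<G> \<gamma> (ginv \<G> \<gamma>)"

definition units :: "'g top_groupoid \<Rightarrow> 'g set" where
  "units \<G> = src \<G> ` arrows \<G>"

definition composable :: "'g top_groupoid \<Rightarrow> ('g \<times> 'g) set" where
  "composable \<G> = {(\<beta>, \<gamma>) \<in> arrows \<G> \<times> arrows \<G>. src \<G> \<beta> = rng \<G> \<gamma>}"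

abbreviation unit_space :: "'g top_groupoid \<Rightarrow> 'g topology" where
  "unit_space \<G> \<equiv> subtopology (gtop \<G>) (units \<G>)"

definition is_groupoid :: "'g top_groupoid \<Rightarrow> bool" where
  "is_groupoid \<G> \<longleftrightarrow>
     (\<forall>\<gamma>\<in>arrows \<G>. ginv \<G> \<gamma> \<in> arrows \<G> \<and>
        src \<G> (ginv \<G> \<gamma>) = rng \<G> \<gamma> \<and> rng \<G> (ginv \<G> \<gamma>) = src \<G> \<gamma> \<and>
        gmult \<G> (rng \<G> \<gamma>) \<gamma> = \<gamma> \<and> gmult \<G> \<gamma> (src \<G> \<gamma>) = \<gamma>) \<and>
     (\<forall>(\<beta>, \<gamma>)\<in>composable \<G>. gmult \<G> \<beta> \<gamma> \<in> arrows \<G> \<and>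
        src \<G> (gmult \<G> \<beta> \<gamma>) = src \<G> \<gamma> \<and> rng \<G> (gmult \<G> \<beta> \<gamma>) = rng \<G> \<beta>) \<and>
     (\<forall>\<alpha> \<beta> \<gamma>. (\<alpha>, \<beta>) \<in> composable \<G> \<longrightarrow> (\<beta>, \<gamma>) \<in> composable \<G> \<longrightarrow>
        gmult \<G> (gmult \<G> \<alpha> \<beta>) \<gamma> = gmult \<G> \<alpha> (gmult \<G> \<beta> \<gamma>))"

definition topological_groupoid :: "'g top_groupoid \<Rightarrow> bool" where
  "topological_groupoid \<G> \<longleftrightarrow> is_groupoid \<G> \<and>
     continuous_map (subtopology (prod_topology (gtop \<G>) (gtop \<G>)) (composable \<G>)) (gtop \<G>)
       (\<lambda>(\<beta>, \<gamma>). gmult \<G> \<beta> \<gamma>) \<and>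
     continuous_map (gtop \<G>) (gtop \<G>) (ginv \<G>)"

definition ample_groupoid :: "'g top_groupoid \<Rightarrow> bool" where
  "ample_groupoid \<G> \<longleftrightarrow> topological_groupoid \<G> \<and>
     locally_compact_space (unit_space \<G>) \<and> Hausdorff_space (unit_space \<G>) \<and>
     has_compact_open_basis (unit_space \<G>) \<and>
     local_homeo (gtop \<G>) (unit_space \<G>) (rng \<G>)"

definition bisection :: "'g top_groupoid \<Rightarrow> 'g set \<Rightarrow> bool" where
  "bisection \<G> U \<longleftrightarrow> U \<subseteq> arrows \<G> \<and> inj_on (src \<G>) U \<and> inj_on (rng \<G>) U"

definition compact_open_bisection :: "'g top_groupoid \<Rightarrow> 'g set \<Rightarrow> bool" where
  "compact_open_bisection \<G> U \<longleftrightarrow>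
     bisection \<G> U \<and> openin (gtop \<G>) U \<and> compact_Hausdorff_in (gtop \<G>) U"

definition iso_bundle :: "'g top_groupoid \<Rightarrow> 'g set" where
  "iso_bundle \<G> = {\<gamma> \<in> arrows \<G>. src \<G> \<gamma> = rng \<G> \<gamma>}"


section \<open>Sheaves of rings over a groupoid\<close>

record ('g, 'e) gsheaf =
  etop :: "'e topology"
  proj :: "'e \<Rightarrow> 'g"
  act :: "'g \<Rightarrow> 'e \<Rightarrow> 'e"

record ('g, 'e) ring_gsheaf = "('g, 'e) gsheaf" +
  stalk :: "'g \<Rightarrow> 'e ring"

definition action_domain :: "'g top_groupoid \<Rightarrow> ('g, 'e, 'm) gsheaf_scheme \<Rightarrow> ('g \<times> 'e) set" where
  "action_domain \<G> \<O> = {(\<gamma>, e) \<in> arrows \<G> \<times> topspace (etop \<O>). src \<G> \<gamma> = proj \<O> e}"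

definition is_gsheaf :: "'g top_groupoid \<Rightarrow> ('g, 'e, 'm) gsheaf_scheme \<Rightarrow> bool" where
  "is_gsheaf \<G> \<O> \<longleftrightarrow>
     local_homeo (etop \<O>) (unit_space \<G>) (proj \<O>) \<and>
     continuous_map (subtopology (prod_topology (gtop \<G>) (etop \<O>)) (action_domain \<G> \<O>)) (etop \<O>)
       (\<lambda>(\<gamma>, e). act \<O> \<gamma> e) \<and>
     (\<forall>e\<in>topspace (etop \<O>). act \<O> (proj \<O> e) e = e) \<and>
     (\<forall>(\<gamma>, e)\<in>action_domain \<G> \<O>. proj \<O> (act \<O> \<gamma> e) = rng \<G> \<gamma>) \<and>
     (\<forall>\<beta> \<gamma> e. (\<beta>, \<gamma>) \<in> composable \<G> \<longrightarrow> (\<gamma>, e) \<in> action_domain \<G> \<O> \<longrightarrow>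
        act \<O> \<beta> (act \<O> \<gamma> e) = act \<O> (gmult \<G> \<beta> \<gamma>) e)"

definition fibre_square :: "('g, 'e, 'm) gsheaf_scheme \<Rightarrow> ('e \<times> 'e) topology" where
  "fibre_square \<O> = subtopology (prod_topology (etop \<O>) (etop \<O>)) {(a, b). proj \<O> a = proj \<O> b}"

definition sheaf_of_rings :: "'g top_groupoid \<Rightarrow> ('g, 'e) ring_gsheaf \<Rightarrow> bool" where
  "sheaf_of_rings \<G> \<O> \<longleftrightarrow> is_gsheaf \<G> \<O> \<and>
     (\<forall>x\<in>units \<G>. ring (stalk \<O> x) \<and> \<one>\<^bsub>stalk \<O> x\<^esub> \<noteq> \<zero>\<^bsub>stalk \<O> x\<^esub> \<and>
        carrier (stalk \<O> x) = {e \<in> topspace (etop \<O>). proj \<O> e = x}) \<and>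
     continuous_map (fibre_square \<O>) (etop \<O>) (\<lambda>(a, b). a \<oplus>\<^bsub>stalk \<O> (proj \<O> a)\<^esub> b) \<and>
     continuous_map (fibre_square \<O>) (etop \<O>) (\<lambda>(a, b). a \<otimes>\<^bsub>stalk \<O> (proj \<O> a)\<^esub> b) \<and>
     continuous_map (unit_space \<G>) (etop \<O>) (\<lambda>x. \<one>\<^bsub>stalk \<O> x\<^esub>) \<and>
     (\<forall>\<gamma>\<in>arrows \<G>. act \<O> \<gamma> \<in> ring_hom (stalk \<O> (src \<G> \<gamma>)) (stalk \<O> (rng \<G> \<gamma>)))"

definition sheaf_of_comm_rings :: "'g top_groupoid \<Rightarrow> ('g, 'e) ring_gsheaf \<Rightarrow> bool" where
  "sheaf_of_comm_rings \<G> \<O> \<longleftrightarrow> sheaf_of_rings \<G> \<O> \<and> (\<forall>x\<in>units \<G>. cring (stalk \<O> x))"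

definition sheaf_of_domains :: "'g top_groupoid \<Rightarrow> ('g, 'e) ring_gsheaf \<Rightarrow> bool" where
  "sheaf_of_domains \<G> \<O> \<longleftrightarrow> sheaf_of_rings \<G> \<O> \<and> (\<forall>x\<in>units \<G>. domain (stalk \<O> x))"

definition ker_sheaf :: "'g top_groupoid \<Rightarrow> ('g, 'e) ring_gsheaf \<Rightarrow> 'g set" where
  "ker_sheaf \<G> \<O> =
     {\<gamma> \<in> iso_bundle \<G>. \<forall>a\<in>carrier (stalk \<O> (src \<G> \<gamma>)). act \<O> \<gamma> a = a}"

abbreviation int_ker :: "'g top_groupoid \<Rightarrow> ('g, 'e) ring_gsheaf \<Rightarrow> 'g set" where
  "int_ker \<G> \<O> \<equiv> gtop \<G> interior_of ker_sheaf \<G> \<O>"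


section \<open>The convolution ring\<close>

text \<open>The additive group of all maps \<open>f\<close> from arrows to the total space with \<open>proj \<circ> f = rng\<close>, under
  pointwise addition. As functions in HOL are total, such maps are normalised to be
  \<^const>\<open>undefined\<close> outside the set of arrows.\<close>

definition section_group :: "'g top_groupoid \<Rightarrow> ('g, 'e) ring_gsheaf \<Rightarrow> ('g \<Rightarrow> 'e) monoid" where
  "section_group \<G> \<O> = product_group (arrows \<G>) (\<lambda>\<gamma>. add_monoid (stalk \<O> (rng \<G> \<gamma>)))"

definition supp :: "'g top_groupoid \<Rightarrow> ('g, 'e) ring_gsheaf \<Rightarrow> ('g \<Rightarrow> 'e) \<Rightarrow> 'g set" where
  "supp \<G> \<O> f = {\<gamma> \<in> arrows \<G>. f \<gamma> \<noteq> \<zero>\<^bsub>stalk \<O> (rng \<G> \<gamma>)\<^esub>}"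

text \<open>\<open>Gamma_c_on \<G> \<O> (arrows \<G>)\<close> is the full convolution ring; for an open subgroupoid \<open>S\<close>,
  \<open>Gamma_c_on \<G> \<O> S\<close> is the convolution ring of \<open>S\<close>, extended by zero.\<close>

definition Gamma_c_on ::
    "'g top_groupoid \<Rightarrow> ('g, 'e) ring_gsheaf \<Rightarrow> 'g set \<Rightarrow> ('g \<Rightarrow> 'e) set" where
  "Gamma_c_on \<G> \<O> S = generate (section_group \<G> \<O>)
     {f \<in> carrier (section_group \<G> \<O>). \<exists>U. compact_open_bisection \<G> U \<and> U \<subseteq> S \<and>
        continuous_map (subtopology (gtop \<G>) U) (etop \<O>) f \<and>
        (\<forall>\<gamma>\<in>arrows \<G> - U. f \<gamma> = \<zero>\<^bsub>stalk \<O> (rng \<G> \<gamma>)\<^esub>)}"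

definition Gamma_c :: "'g top_groupoid \<Rightarrow> ('g, 'e) ring_gsheaf \<Rightarrow> ('g \<Rightarrow> 'e) set" where
  "Gamma_c \<G> \<O> = Gamma_c_on \<G> \<O> (arrows \<G>)"

text \<open>The sum ranges over the factorisations with a nonzero term only: there are finitely many of
  these for elements of \<^const>\<open>Gamma_c\<close>, whereas \<^const>\<open>finsum\<close> over an infinite index set is zero by
  convention.\<close>

definition conv ::
    "'g top_groupoid \<Rightarrow> ('g, 'e) ring_gsheaf \<Rightarrow> ('g \<Rightarrow> 'e) \<Rightarrow> ('g \<Rightarrow> 'e) \<Rightarrow> 'g \<Rightarrow> 'e" where
  "conv \<G> \<O> f g = (\<lambda>\<gamma>\<in>arrows \<G>.
     let R = stalk \<O> (rng \<G> \<gamma>); t = (\<lambda>(\<beta>, \<rho>). f \<beta> \<otimes>\<^bsub>R\<^esub> act \<O> \<beta> (g \<rho>))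
     in finsum R t {q \<in> composable \<G>. gmult \<G> (fst q) (snd q) = \<gamma> \<and> t q \<noteq> \<zero>\<^bsub>R\<^esub>})"

text \<open>Compactly supported continuous sections over the unit space, extended by zero to all arrows.
  For a unit \<open>x\<close> one has \<open>rng \<G> x = x\<close>, so membership in \<^const>\<open>section_group\<close> says that the
  restriction to the units is a section of \<^const>\<open>proj\<close>.\<close>

definition Gamma_c_units :: "'g top_groupoid \<Rightarrow> ('g, 'e) ring_gsheaf \<Rightarrow> ('g \<Rightarrow> 'e) set" where
  "Gamma_c_units \<G> \<O> = {f \<in> carrier (section_group \<G> \<O>).
     continuous_map (unit_space \<G>) (etop \<O>) f \<and>
     compact_Hausdorff_in (unit_space \<G>) {x \<in> units \<G>. f x \<noteq> \<zero>\<^bsub>stalk \<O> x\<^esub>} \<and>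
     (\<forall>\<gamma>\<in>arrows \<G> - units \<G>. f \<gamma> = \<zero>\<^bsub>stalk \<O> (rng \<G> \<gamma>)\<^esub>)}"

text \<open>\<^const>\<open>Gamma_c\<close> is in general not unital (it has an identity only when the unit space is
  compact), so a subring is an additive subgroup closed under convolution.\<close>

definition conv_subring :: "'g top_groupoid \<Rightarrow> ('g, 'e) ring_gsheaf \<Rightarrow> ('g \<Rightarrow> 'e) set \<Rightarrow> bool" where
  "conv_subring \<G> \<O> S \<longleftrightarrow> S \<subseteq> Gamma_c \<G> \<O> \<and> subgroup S (section_group \<G> \<O>) \<and>
     (\<forall>f\<in>S. \<forall>g\<in>S. conv \<G> \<O> f g \<in> S)"

definition comm_conv_subring ::
    "'g top_groupoid \<Rightarrow> ('g, 'e) ring_gsheaf \<Rightarrow> ('g \<Rightarrow> 'e) set \<Rightarrow> bool" where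
  "comm_conv_subring \<G> \<O> S \<longleftrightarrow> conv_subring \<G> \<O> S \<and>
     (\<forall>f\<in>S. \<forall>g\<in>S. conv \<G> \<O> f g = conv \<G> \<O> g f)"

definition maximal_comm_subring ::
    "'g top_groupoid \<Rightarrow> ('g, 'e) ring_gsheaf \<Rightarrow> ('g \<Rightarrow> 'e) set \<Rightarrow> bool" where
  "maximal_comm_subring \<G> \<O> S \<longleftrightarrow> comm_conv_subring \<G> \<O> S \<and>
     (\<forall>T. comm_conv_subring \<G> \<O> T \<longrightarrow> S \<subseteq> T \<longrightarrow> T = S)"

end

(* Commuting with the sections over the unit space is a pointwise condition:
   f(gamma) * alpha_gamma(g(s gamma)) = g(r gamma) * f(gamma) for all such g. In integral domains
   f(gamma) cancels if it is nonzero, and g is arbitrary enough to force gamma into ker O; so a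
   commutative ring containing the sections over the units is supported in ker O.

   Conversely, a compact open bisection U inside Int(ker O) and not inside the unit space gives an
   indicator function 1_U. On arrows of ker O convolution does not see the action, so the sections
   supported in the bicommutant W of U inside ker O form a commutative ring. It contains 1_U and
   all sections over the units, against maximality. *)

theory Submission
  imports Defs
begin

section \<open>Local homeomorphisms\<close>

text \<open>The arrows of ker O at a unit x form a group that may be non-abelian, so a commutative
  ring containing 1_U cannot use all of them. The bisection U has at most one arrow in that group,
  and an arrow commutes with itself; the double centralizer of commuting elements is an abelian
  subgroup that contains them. The bicommutant W is the union of these subgroups. It need not be
  open, so the competing ring is cut out of the full convolution ring by a condition on supports
  rather than generated by sections over bisections inside W. The other obstacle is that the arrow
  space need not be Hausdorff. Compact sets of arrows may fail to be closed, which matters when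
  products of compact open bisections are shown to be compact; closedness is therefore always tested
  in the unit space. The cancellation argument places supports only in ker O, not in its interior.
  The equality assumed for Gamma_c(Int(ker O), O) bridges exactly this gap.\<close>

lemma local_homeo_open_map:
  assumes "local_homeo X Y f"
  shows "open_map X Y f"
  unfolding open_map_def
proof (intro allI impI)
  fix S assume S: "openin X S"
  show "openin Y (f ` S)"
  proof (subst openin_subopen, intro ballI)
    fix y assume "y \<in> f ` S"
    then obtain x where x: "x \<in> S" "y = f x" by blast
    have "x \<in> topspace X"
      using x(1) openin_subset[OF S] by blast
    then obtain U where U: "openin X U" "x \<in> U" "openin Y (f ` U)"
      "homeomorphic_map (subtopology X U) (subtopology Y (f ` U)) f"
      using assms unfolding local_homeo_def by blast
    have "openin (subtopology X U) (S \<inter> U)"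
      using S by (simp add: openin_subtopology_Int)
    then have "openin (subtopology Y (f ` U)) (f ` (S \<inter> U))"
      using homeomorphic_imp_open_map[OF U(4)] by (simp add: open_map_def)
    then have "openin Y (f ` (S \<inter> U))"
      using U(3) openin_trans_full by blast
    then show "\<exists>T. openin Y T \<and> y \<in> T \<and> T \<subseteq> f ` S"
      using x U(2) by blast
  qed
qed

lemma local_homeo_locally_inj:
  assumes "local_homeo X Y f" "x \<in> topspace X"
  obtains U where "openin X U" "x \<in> U" "inj_on f U"
proof -
  obtain U where U: "openin X U" "x \<in> U" "homeomorphic_map (subtopology X U) (subtopology Y (f ` U)) f"
    using assms unfolding local_homeo_def by blast
  then have "inj_on f U"
    using homeomorphic_imp_injective_map openin_subset[OF U(1)]
    by (metis topspace_subtopology_subset)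
  with U that show ?thesis by blast
qed

text \<open>The preimage of an open \<open>S\<close> under the inverse is the image of
  \<open>S \<inter> U\<close>, which is open because \<open>f\<close> is an open map. Applied to
  \<open>r\<close> and to \<open>p\<close>, this yields continuous local sections.\<close>

lemma open_map_continuous_inv_into:
  assumes f: "open_map X Y f" and U: "openin X U" and inj: "inj_on f U"
  shows "continuous_map (subtopology Y (f ` U)) X (inv_into U f)"
proof -
  have fU: "openin Y (f ` U)"
    using f U by (simp add: open_map_def)
  have "openin (subtopology Y (f ` U)) {y \<in> topspace (subtopology Y (f ` U)). inv_into U f y \<in> S}"
    if S: "openin X S" for S
  proof -
    have "{y \<in> topspace (subtopology Y (f ` U)). inv_into U f y \<in> S} = f ` (S \<inter> U)"
      using inj openin_subset[OF fU] by auto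
    moreover have "openin Y (f ` (S \<inter> U))"
      using f S U by (simp add: open_map_def openin_Int)
    ultimately show ?thesis
      using openin_open_subtopology[OF fU] by auto
  qed
  moreover have "inv_into U f \<in> topspace (subtopology Y (f ` U)) \<rightarrow> topspace X"
    using openin_subset[OF U] inv_into_into[of _ f U] by auto
  ultimately show ?thesis
    unfolding continuous_map_def by blast
qed

lemma continuous_map_in_topspace: "\<lbrakk>continuous_map X Y f; x \<in> topspace X\<rbrakk> \<Longrightarrow> f x \<in> topspace Y"
  by (auto simp: continuous_map_def)

section \<open>Ample groupoids\<close>

locale ample =
  fixes \<G> :: "'g top_groupoid"
  assumes ample: "ample_groupoid \<G>"
begin

abbreviation mult (infixl \<open>\<cdot>\<close> 70) where "\<beta> \<cdot> \<gamma> \<equiv> gmult \<G> \<beta> \<gamma>"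
abbreviation s where "s \<equiv> src \<G>"
abbreviation r where "r \<equiv> rng \<G>"
abbreviation iv where "iv \<equiv> ginv \<G>"
abbreviation T where "T \<equiv> gtop \<G>"
abbreviation A where "A \<equiv> arrows \<G>"
abbreviation X where "X \<equiv> units \<G>"

lemma topological: "topological_groupoid \<G>"
  using ample by (simp add: ample_groupoid_def)

lemma groupoid: "is_groupoid \<G>"
  using topological by (simp add: topological_groupoid_def)

section \<open>Algebra of arrows and units\<close>

lemma composable_iff: "(\<beta>, \<gamma>) \<in> composable \<G> \<longleftrightarrow> \<beta> \<in> A \<and> \<gamma> \<in> A \<and> s \<beta> = r \<gamma>"
  by (auto simp: composable_def)

lemma
  assumes "\<gamma> \<in> A"
  shows inv_arrow [simp]: "iv \<gamma> \<in> A"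
    and src_inv [simp]: "s (iv \<gamma>) = r \<gamma>"
    and rng_inv [simp]: "r (iv \<gamma>) = s \<gamma>"
    and rng_mult_left [simp]: "r \<gamma> \<cdot> \<gamma> = \<gamma>"
    and mult_src_right [simp]: "\<gamma> \<cdot> s \<gamma> = \<gamma>"
  using groupoid assms by (auto simp: is_groupoid_def)

lemma
  assumes "\<beta> \<in> A" "\<gamma> \<in> A" "s \<beta> = r \<gamma>"
  shows mult_arrow [simp]: "\<beta> \<cdot> \<gamma> \<in> A"
    and src_mult [simp]: "s (\<beta> \<cdot> \<gamma>) = s \<gamma>"
    and rng_mult [simp]: "r (\<beta> \<cdot> \<gamma>) = r \<beta>"
proof -
  have "(\<beta>, \<gamma>) \<in> composable \<G>" using assms by (simp add: composable_iff)
  then show "\<beta> \<cdot> \<gamma> \<in> A" "s (\<beta> \<cdot> \<gamma>) = s \<gamma>" "r (\<beta> \<cdot> \<gamma>) = r \<beta>"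
    using groupoid unfolding is_groupoid_def by fast+
qed

lemma mult_assoc:
  assumes "\<alpha> \<in> A" "\<beta> \<in> A" "\<gamma> \<in> A" "s \<alpha> = r \<beta>" "s \<beta> = r \<gamma>"
  shows "(\<alpha> \<cdot> \<beta>) \<cdot> \<gamma> = \<alpha> \<cdot> (\<beta> \<cdot> \<gamma>)"
  using groupoid assms unfolding is_groupoid_def by (simp add: composable_iff)

lemma inv_mult: "iv \<gamma> \<cdot> \<gamma> = s \<gamma>" and mult_inv: "\<gamma> \<cdot> iv \<gamma> = r \<gamma>"
  by (simp_all add: src_def rng_def)

lemma src_arrow [simp]: "\<gamma> \<in> A \<Longrightarrow> s \<gamma> \<in> A"
  by (metis inv_mult inv_arrow mult_arrow src_inv)

lemma rng_arrow [simp]: "\<gamma> \<in> A \<Longrightarrow> r \<gamma> \<in> A"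
  by (metis inv_arrow src_arrow src_inv)

lemma src_src [simp]: "\<gamma> \<in> A \<Longrightarrow> s (s \<gamma>) = s \<gamma>"
  by (metis inv_mult inv_arrow src_mult src_inv)

lemma rng_src [simp]: "\<gamma> \<in> A \<Longrightarrow> r (s \<gamma>) = s \<gamma>"
  by (metis inv_mult inv_arrow rng_mult src_inv rng_inv)

lemma src_rng [simp]: "\<gamma> \<in> A \<Longrightarrow> s (r \<gamma>) = r \<gamma>"
  by (metis inv_arrow src_inv src_src)

lemma rng_rng [simp]: "\<gamma> \<in> A \<Longrightarrow> r (r \<gamma>) = r \<gamma>"
  by (metis inv_arrow src_inv rng_src)

lemma unit_arrow [simp]: "x \<in> X \<Longrightarrow> x \<in> A"
  and src_unit [simp]: "x \<in> X \<Longrightarrow> s x = x"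
  and rng_unit [simp]: "x \<in> X \<Longrightarrow> r x = x"
  by (auto simp: units_def)

lemma units_subset: "X \<subseteq> A"
  by auto

lemma src_in_units [simp]: "\<gamma> \<in> A \<Longrightarrow> s \<gamma> \<in> X"
  unfolding units_def by (rule imageI)

lemma rng_in_units [simp]: "\<gamma> \<in> A \<Longrightarrow> r \<gamma> \<in> X"
  by (metis inv_arrow src_inv src_in_units)

lemma inv_mult_cancel:
  assumes "\<beta> \<in> A" "\<rho> \<in> A" "s \<beta> = r \<rho>"
  shows "iv \<beta> \<cdot> (\<beta> \<cdot> \<rho>) = \<rho>"
  using mult_assoc[of "iv \<beta>" \<beta> \<rho>] assms by (simp add: inv_mult)

lemma mult_inv_cancel:
  assumes "\<beta> \<in> A" "\<gamma> \<in> A" "r \<beta> = r \<gamma>"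
  shows "\<beta> \<cdot> (iv \<beta> \<cdot> \<gamma>) = \<gamma>"
  using mult_assoc[of \<beta> "iv \<beta>" \<gamma>] assms by (simp add: mult_inv)

lemma inv_inv [simp]:
  assumes "\<gamma> \<in> A"
  shows "iv (iv \<gamma>) = \<gamma>"
  using inv_mult_cancel[of "iv \<gamma>" \<gamma>] mult_src_right[of "iv (iv \<gamma>)"] assms by (simp add: inv_mult)

section \<open>Continuity of the structure maps and the topology of the unit space\<close>

lemma topspace_units [simp]: "topspace (unit_space \<G>) = X"
  using units_subset by (auto simp: topspace_subtopology)

lemma continuous_inv: "continuous_map T T iv"
  using topological by (simp add: topological_groupoid_def)

lemma continuous_mult:
  assumes "continuous_map Z T f" "continuous_map Z T g" "\<And>z. z \<in> topspace Z \<Longrightarrow> s (f z) = r (g z)"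
  shows "continuous_map Z T (\<lambda>z. f z \<cdot> g z)"
proof -
  have "continuous_map Z (subtopology (prod_topology T T) (composable \<G>)) (\<lambda>z. (f z, g z))"
    using assms(3) continuous_map_in_topspace[OF assms(1)] continuous_map_in_topspace[OF assms(2)]
    by (auto simp: continuous_map_in_subtopology composable_iff intro!: continuous_map_pairedI assms)
  moreover have "continuous_map (subtopology (prod_topology T T) (composable \<G>)) T (\<lambda>(\<beta>, \<gamma>). \<beta> \<cdot> \<gamma>)"
    using topological by (simp add: topological_groupoid_def)
  ultimately have "continuous_map Z T ((\<lambda>(\<beta>, \<gamma>). \<beta> \<cdot> \<gamma>) \<circ> (\<lambda>z. (f z, g z)))"
    by (rule continuous_map_compose)
  then show ?thesis
    by (simp add: o_def)
qed

lemma continuous_rng: "continuous_map T (unit_space \<G>) r"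
proof -
  have "continuous_map T T (\<lambda>\<gamma>. \<gamma> \<cdot> iv \<gamma>)"
    by (intro continuous_mult continuous_inv) auto
  then show ?thesis
    by (auto simp: continuous_map_in_subtopology mult_inv)
qed

lemma continuous_src: "continuous_map T (unit_space \<G>) s"
proof -
  have "continuous_map T T (\<lambda>\<gamma>. iv \<gamma> \<cdot> \<gamma>)"
    by (intro continuous_mult continuous_inv) auto
  then show ?thesis
    by (auto simp: continuous_map_in_subtopology inv_mult)
qed

lemma local_homeo_rng: "local_homeo T (unit_space \<G>) r"
  and Hausdorff_units: "Hausdorff_space (unit_space \<G>)"
  using ample by (simp_all add: ample_groupoid_def)

lemma open_map_rng: "open_map T (unit_space \<G>) r"
  by (rule local_homeo_open_map[OF local_homeo_rng])

text \<open>Near a unit \<open>x\<close>, the local section of \<open>r\<close> through \<open>x\<close> is the inclusion of the units.\<close>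

lemma openin_units: "openin T X"
proof (subst openin_subopen, intro ballI)
  fix x assume x: "x \<in> X"
  obtain U where U: "openin T U" "x \<in> U" "inj_on r U"
    using local_homeo_locally_inj[OF local_homeo_rng] unit_arrow[OF x] by blast
  \<comment> \<open>For \<gamma> in \<open>U \<inter> ?V\<close>, both \<gamma> and
    \<open>r \<gamma>\<close> lie in \<open>U\<close> and have the same range. Injectivity of
    \<open>r\<close> on \<open>U\<close> identifies them.\<close>
  let ?V = "{\<gamma> \<in> A. r \<gamma> \<in> U \<inter> X}"
  have "openin T ?V"
    using U(1) by (intro openin_continuous_map_preimage[OF continuous_rng]) (rule openin_subtopology_Int)
  then have "openin T (U \<inter> ?V)"
    using U by blast
  moreover have "U \<inter> ?V \<subseteq> X"
  proof
    fix \<gamma> assume \<gamma>: "\<gamma> \<in> U \<inter> ?V"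
    then have "r \<gamma> = \<gamma>"
      using inj_onD[OF U(3), of "r \<gamma>" \<gamma>] by auto
    then show "\<gamma> \<in> X" using \<gamma> by auto
  qed
  ultimately show "\<exists>V. openin T V \<and> x \<in> V \<and> V \<subseteq> X"
    using x U(2) by (intro exI[of _ "U \<inter> ?V"]) auto
qed

lemma openin_units_iff: "openin (unit_space \<G>) V \<longleftrightarrow> openin T V \<and> V \<subseteq> X"
  by (rule openin_open_subtopology[OF openin_units])

lemma compactin_units_iff: "compactin (unit_space \<G>) K \<longleftrightarrow> compactin T K \<and> K \<subseteq> X"
  by (rule compactin_subtopology)

lemma compact_open_unit_nbhd:
  assumes "openin (unit_space \<G>) V" "x \<in> V"
  obtains K where "openin (unit_space \<G>) K" "compactin (unit_space \<G>) K" "x \<in> K" "K \<subseteq> V"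
proof -
  have "(arbitrary union_of (\<lambda>K. openin (unit_space \<G>) K \<and> compact_Hausdorff_in (unit_space \<G>) K)) V"
    using ample assms(1) unfolding ample_groupoid_def has_compact_open_basis_def by metis
  then obtain K where "openin (unit_space \<G>) K \<and> compact_Hausdorff_in (unit_space \<G>) K" "x \<in> K" "K \<subseteq> V"
    using assms(2) by (force simp: union_of_def arbitrary_def)
  then show ?thesis
    using that by (auto simp: compact_Hausdorff_in_def)
qed

text \<open>\<open>r\<close> is a continuous injection of a bisection into the Hausdorff unit space.
  For bisections the Hausdorff half of \<open>compact_Hausdorff_in\<close> is thus automatic,
  although the arrow space itself may fail to be Hausdorff.\<close>

lemma bisection_Hausdorff:
  assumes "bisection \<G> U"
  shows "Hausdorff_space (subtopology T U)"
proof (rule Hausdorff_space_injective_preimage[OF Hausdorff_units])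
  show "continuous_map (subtopology T U) (unit_space \<G>) r"
    by (rule continuous_map_from_subtopology[OF continuous_rng])
  show "inj_on r (topspace (subtopology T U))"
    using assms by (auto simp: bisection_def intro: inj_on_subset)
qed

lemma compact_open_bisection_iff:
  "compact_open_bisection \<G> U \<longleftrightarrow> bisection \<G> U \<and> openin T U \<and> compactin T U"
  using bisection_Hausdorff by (auto simp: compact_open_bisection_def compact_Hausdorff_in_def)

lemma compact_open_bisection_units:
  assumes "openin (unit_space \<G>) K" "compactin (unit_space \<G>) K"
  shows "compact_open_bisection \<G> K"
proof -
  have "K \<subseteq> X" using assms openin_units_iff by simp
  then have "bisection \<G> K"
    by (auto simp: bisection_def inj_on_def subset_iff)
  then show ?thesis
    using assms by (simp add: compact_open_bisection_iff openin_units_iff compactin_units_iff)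
qed

lemma rng_inverse:
  assumes U: "openin T U" and inj: "inj_on r U"
  shows "openin (unit_space \<G>) (r ` U)"
    and "continuous_map (subtopology (unit_space \<G>) (r ` U)) T (inv_into U r)"
  using open_map_rng U open_map_continuous_inv_into[OF open_map_rng U inj]
  by (auto simp: open_map_def)

lemma compact_open_bisection_nbhd:
  assumes V: "openin T V" "\<gamma> \<in> V"
  obtains U where "compact_open_bisection \<G> U" "\<gamma> \<in> U" "U \<subseteq> V"
proof -
  have \<gamma>: "\<gamma> \<in> A" using V openin_subset by blast
  obtain U1 where U1: "openin T U1" "\<gamma> \<in> U1" "inj_on r U1"
    using local_homeo_locally_inj[OF local_homeo_rng \<gamma>] by blast
  \<comment> \<open>Only \<open>r\<close> is assumed to be a local homeomorphism. As
    \<open>s \<gamma> = r (iv \<gamma>)\<close>, injectivity of \<open>s\<close> near \<gamma> is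
    obtained from injectivity of \<open>r\<close> near \<open>iv \<gamma>\<close>.\<close>
  obtain U2 where U2: "openin T U2" "iv \<gamma> \<in> U2" "inj_on r U2"
    using local_homeo_locally_inj[OF local_homeo_rng inv_arrow[OF \<gamma>]] by blast
  define U3 where "U3 = V \<inter> (U1 \<inter> {\<delta> \<in> A. iv \<delta> \<in> U2})"
  have "openin T {\<delta> \<in> A. iv \<delta> \<in> U2}"
    using openin_continuous_map_preimage[OF continuous_inv U2(1)] .
  then have U3: "openin T U3" "\<gamma> \<in> U3" "U3 \<subseteq> A" "U3 \<subseteq> V"
    using V U1 U2 \<gamma> by (auto simp: U3_def)
  have rinj: "inj_on r U3"
    using U1(3) by (auto simp: U3_def intro: inj_on_subset)
  have sinj: "inj_on s U3"
  proof (rule inj_onI)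
    fix a b assume *: "a \<in> U3" "b \<in> U3" "s a = s b"
    then have "r (iv a) = r (iv b)" "iv a \<in> U2" "iv b \<in> U2" "a \<in> A" "b \<in> A"
      by (auto simp: U3_def)
    then show "a = b"
      using U2(3) by (metis inj_onD inv_inv)
  qed
  note ri = rng_inverse[OF U3(1) rinj]
  obtain K where K: "openin (unit_space \<G>) K" "compactin (unit_space \<G>) K" "r \<gamma> \<in> K" "K \<subseteq> r ` U3"
    using compact_open_unit_nbhd[OF ri(1)] U3(2) by blast
  \<comment> \<open>This set is the part of \<open>U3\<close> over the open set \<open>K\<close>,
    hence open; it is also the image of the compact set \<open>K\<close> under the continuous
    inverse of \<open>r\<close> on \<open>U3\<close>, hence compact.\<close>
  define U where "U = {\<delta> \<in> U3. r \<delta> \<in> K}"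
  have "openin T {\<delta> \<in> A. r \<delta> \<in> K}"
    by (rule openin_continuous_map_preimage[OF continuous_rng K(1)])
  then have "openin T (U3 \<inter> {\<delta> \<in> A. r \<delta> \<in> K})"
    using U3 by blast
  moreover have "U3 \<inter> {\<delta> \<in> A. r \<delta> \<in> K} = U"
    using U3 by (auto simp: U_def)
  ultimately have Uo: "openin T U" by simp
  have "compactin (subtopology (unit_space \<G>) (r ` U3)) K"
    using K by (simp add: compactin_subtopology)
  then have "compactin T (inv_into U3 r ` K)"
    using image_compactin ri(2) by blast
  moreover have "inv_into U3 r ` K = U"
  proof (intro equalityI subsetI)
    fix \<delta> assume "\<delta> \<in> inv_into U3 r ` K"
    then show "\<delta> \<in> U"
      using K(4) rinj by (auto simp: U_def subset_iff)
  next
    fix \<delta> assume "\<delta> \<in> U"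
    then show "\<delta> \<in> inv_into U3 r ` K"
      using rinj by (intro image_eqI[of _ _ "r \<delta>"]) (auto simp: U_def)
  qed
  ultimately have "compact_open_bisection \<G> U"
    using Uo rinj sinj U3(3) by (auto simp: compact_open_bisection_iff bisection_def U_def inj_on_def)
  then show ?thesis
    using that U3 K(3) by (auto simp: U_def)
qed

section \<open>Products of compact open bisections\<close>

definition set_mult :: "'g set \<Rightarrow> 'g set \<Rightarrow> 'g set" where
  "set_mult U V = {\<gamma>. \<exists>u\<in>U. \<exists>v\<in>V. s u = r v \<and> \<gamma> = u \<cdot> v}"

text \<open>An arrow \<open>w\<close> of the product determines its left factor as the only arrow of
  \<open>U\<close> with range \<open>r w\<close>, and then its right factor. This describes the
  product through functions of \<open>w\<close> that turn out to be continuous.\<close>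

lemma set_mult_eq:
  assumes U: "compact_open_bisection \<G> U" and V: "V \<subseteq> A"
  shows "set_mult U V = {w \<in> A. r w \<in> r ` U \<and> iv (inv_into U r (r w)) \<cdot> w \<in> V}"
proof -
  have UA: "U \<subseteq> A" and inj: "inj_on r U"
    using U by (auto simp: compact_open_bisection_def bisection_def)
  show ?thesis
  proof (intro equalityI subsetI)
    fix w assume "w \<in> set_mult U V"
    then show "w \<in> {w \<in> A. r w \<in> r ` U \<and> iv (inv_into U r (r w)) \<cdot> w \<in> V}"
      using UA V inj by (auto simp: set_mult_def inv_mult_cancel subset_iff)
  next
    fix w assume w: "w \<in> {w \<in> A. r w \<in> r ` U \<and> iv (inv_into U r (r w)) \<cdot> w \<in> V}"
    then obtain u where u: "u \<in> U" "r u = r w" "iv u \<cdot> w \<in> V" "w \<in> A"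
      using inj by auto
    moreover have "u \<cdot> (iv u \<cdot> w) = w" "s u = r (iv u \<cdot> w)"
      using u UA by (auto simp: mult_inv_cancel)
    ultimately show "w \<in> set_mult U V"
      unfolding set_mult_def by (metis (mono_tags, lifting) mem_Collect_eq)
  qed
qed

text \<open>The source space is left arbitrary because two kinds of map are inserted for
  \<open>f\<close>: inclusions, which give the factors of a product, and the source map
  \<open>s\<close>, which recovers from \<open>u\<close> the arrow of a bisection that can follow
  it.\<close>

lemma continuous_left_factor:
  assumes U: "compact_open_bisection \<G> U" and f: "continuous_map Z T f" "f ` topspace Z \<subseteq> {w. r w \<in> r ` U}"
  shows "continuous_map Z T (\<lambda>z. inv_into U r (r (f z)))"
proof -
  have "continuous_map (subtopology (unit_space \<G>) (r ` U)) T (inv_into U r)"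
    using U by (intro rng_inverse) (auto simp: compact_open_bisection_def bisection_def)
  moreover have "continuous_map Z (subtopology (unit_space \<G>) (r ` U)) (\<lambda>z. r (f z))"
    using f continuous_map_compose[OF f(1) continuous_rng]
    by (subst continuous_map_in_subtopology) (auto simp: o_def)
  ultimately have "continuous_map Z T (inv_into U r \<circ> (\<lambda>z. r (f z)))"
    by (metis continuous_map_compose)
  then show ?thesis
    by (simp add: o_def)
qed

lemma continuous_right_factor:
  assumes U: "compact_open_bisection \<G> U" and f: "continuous_map Z T f" "f ` topspace Z \<subseteq> {w. r w \<in> r ` U}"
  shows "continuous_map Z T (\<lambda>z. iv (inv_into U r (r (f z))) \<cdot> f z)"
proof (rule continuous_mult)
  note L = continuous_left_factor[OF U f]
  show "continuous_map Z T (\<lambda>z. iv (inv_into U r (r (f z))))"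
    using continuous_map_compose[OF L continuous_inv] by (simp add: o_def)
  fix z assume z: "z \<in> topspace Z"
  then have "inv_into U r (r (f z)) \<in> A"
    by (rule continuous_map_in_topspace[OF L])
  moreover have "r (f z) \<in> r ` U"
    using z f(2) by blast
  then have "r (inv_into U r (r (f z))) = r (f z)"
    by (rule f_inv_into_f)
  ultimately show "s (iv (inv_into U r (r (f z)))) = r (f z)"
    by simp
qed (rule f)

text \<open>This is what keeps the convolution of two generators a generator. Openness follows from
  continuity of the right factor as a function of the product, compactness from parametrizing the
  product by its left factors.\<close>

lemma compact_open_bisection_mult:
  assumes U: "compact_open_bisection \<G> U" and V: "compact_open_bisection \<G> V"
  shows "compact_open_bisection \<G> (set_mult U V)"
proof -
  have UA: "U \<subseteq> A" "openin T U" "compactin T U" "inj_on r U" "inj_on s U"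
    and VA: "V \<subseteq> A" "openin T V" "compactin T V" "inj_on r V" "inj_on s V"
    using U V by (auto simp: compact_open_bisection_iff bisection_def)
  have sub: "set_mult U V \<subseteq> A"
    using UA VA by (auto simp: set_mult_def subset_iff)
  have "inj_on r (set_mult U V)"
  proof (rule inj_onI)
    fix a b assume "a \<in> set_mult U V" "b \<in> set_mult U V" and eq: "r a = r b"
    then obtain u v u' v' where *: "u \<in> U" "v \<in> V" "s u = r v" "a = u \<cdot> v"
      "u' \<in> U" "v' \<in> V" "s u' = r v'" "b = u' \<cdot> v'"
      by (auto simp: set_mult_def)
    then have "r u = r u'" using eq UA VA by (simp add: subset_iff)
    then have "u = u'" using * UA by (meson inj_onD)
    moreover from this have "v = v'" using * VA by (metis inj_onD)
    ultimately show "a = b" using * by simp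
  qed
  moreover have "inj_on s (set_mult U V)"
  proof (rule inj_onI)
    fix a b assume "a \<in> set_mult U V" "b \<in> set_mult U V" and eq: "s a = s b"
    then obtain u v u' v' where *: "u \<in> U" "v \<in> V" "s u = r v" "a = u \<cdot> v"
      "u' \<in> U" "v' \<in> V" "s u' = r v'" "b = u' \<cdot> v'"
      by (auto simp: set_mult_def)
    then have "s v = s v'" using eq UA VA by (simp add: subset_iff)
    then have "v = v'" using * VA by (meson inj_onD)
    moreover from this have "u = u'" using * UA by (metis inj_onD)
    ultimately show "a = b" using * by simp
  qed
  moreover have "openin T (set_mult U V)"
  proof -
    let ?D = "{w \<in> A. r w \<in> r ` U}"
    have D: "openin T ?D"
      using UA by (intro openin_continuous_map_preimage[OF continuous_rng] rng_inverse)
    have "continuous_map (subtopology T ?D) T (\<lambda>w. iv (inv_into U r (r w)) \<cdot> w)"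
      by (rule continuous_right_factor[OF U]) auto
    then have "openin (subtopology T ?D) {w \<in> topspace (subtopology T ?D). iv (inv_into U r (r w)) \<cdot> w \<in> V}"
      using VA(2) by (rule openin_continuous_map_preimage)
    then have "openin T {w \<in> topspace (subtopology T ?D). iv (inv_into U r (r w)) \<cdot> w \<in> V}"
      using D openin_trans_full by blast
    moreover have "{w \<in> topspace (subtopology T ?D). iv (inv_into U r (r w)) \<cdot> w \<in> V} = set_mult U V"
      unfolding set_mult_eq[OF U VA(1)] by auto
    ultimately show ?thesis by simp
  qed
  moreover have "compactin T (set_mult U V)"
  proof -
    \<comment> \<open>These are the possible left factors. The image of \<open>V\<close> under
      \<open>r\<close> is compact in the Hausdorff unit space, hence closed there, and pulling it
      back along \<open>s\<close> gives a closed set of arrows. So \<open>?C \<inter> U\<close> is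
      compact, and multiplication maps it continuously onto the product.\<close>
    let ?C = "{u \<in> A. s u \<in> r ` V}"
    have "compactin (unit_space \<G>) (r ` V)"
      using image_compactin[OF VA(3) continuous_rng] .
    then have "closedin (unit_space \<G>) (r ` V)"
      using Hausdorff_units compactin_imp_closedin by blast
    then have "closedin T ?C"
      using closedin_continuous_map_preimage[OF continuous_src] by blast
    then have "compactin T (?C \<inter> U)"
      using UA(3) closed_Int_compactin by blast
    then have C: "compactin (subtopology T (?C \<inter> U)) (?C \<inter> U)"
      by (simp add: compactin_subtopology)
    have c: "continuous_map (subtopology T (?C \<inter> U)) T (\<lambda>u. u \<cdot> inv_into V r (s u))"
    proof (rule continuous_mult)
      have "continuous_map (subtopology T (?C \<inter> U)) T s"
        using continuous_src continuous_map_from_subtopology by (simp add: continuous_map_in_subtopology)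
      then have "continuous_map (subtopology T (?C \<inter> U)) T (\<lambda>u. inv_into V r (r (s u)))"
        using VA(1) by (intro continuous_left_factor[OF V]) (auto simp: subset_iff)
      then show "continuous_map (subtopology T (?C \<inter> U)) T (\<lambda>u. inv_into V r (s u))"
        by (rule continuous_map_eq) auto
    qed (auto simp: f_inv_into_f)
    have "(\<lambda>u. u \<cdot> inv_into V r (s u)) ` (?C \<inter> U) = set_mult U V"
    proof (intro equalityI subsetI)
      fix w assume "w \<in> (\<lambda>u. u \<cdot> inv_into V r (s u)) ` (?C \<inter> U)"
      then obtain u v where "u \<in> U" "v \<in> V" "s u = r v" "w = u \<cdot> v"
        using VA(4) by force
      then show "w \<in> set_mult U V" by (auto simp: set_mult_def)
    next
      fix w assume "w \<in> set_mult U V"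
      then obtain u v where "u \<in> U" "v \<in> V" "s u = r v" "w = u \<cdot> v"
        by (auto simp: set_mult_def)
      then show "w \<in> (\<lambda>u. u \<cdot> inv_into V r (s u)) ` (?C \<inter> U)"
        using UA(1) VA(4) by (intro image_eqI[of _ _ u]) auto
    qed
    with image_compactin[OF C c] show ?thesis by simp
  qed
  ultimately show ?thesis
    using sub by (simp add: compact_open_bisection_iff bisection_def)
qed

end

section \<open>Sheaves of rings\<close>

lemma continuous_map_locally:
  assumes "\<And>x. x \<in> topspace X \<Longrightarrow> \<exists>U. openin X U \<and> x \<in> U \<and> continuous_map (subtopology X U) Y f"
  shows "continuous_map X Y f"
  by (rule pasting_lemma[where I = "{U. openin X U \<and> continuous_map (subtopology X U) Y f}"
        and T = "\<lambda>U. U" and f = "\<lambda>_. f"]) (use assms in auto)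

lemma local_homeo_continuous:
  assumes "local_homeo X Y f"
  shows "continuous_map X Y f"
proof (rule continuous_map_locally)
  fix x assume "x \<in> topspace X"
  then obtain U where U: "openin X U" "x \<in> U"
    "homeomorphic_map (subtopology X U) (subtopology Y (f ` U)) f"
    using assms unfolding local_homeo_def by blast
  moreover have "continuous_map (subtopology X U) Y f"
    using homeomorphic_imp_continuous_map[OF U(3)] by (simp add: continuous_map_in_subtopology)
  ultimately show "\<exists>U. openin X U \<and> x \<in> U \<and> continuous_map (subtopology X U) Y f"
    by blast
qed

text \<open>A map that is multiplicative just on the generated subgroup already preserves the unit
  and inverses there. The map will be convolution with a fixed factor, whose additivity is available
  only where the defining sums are finite.\<close>

lemma (in group) generate_hom_closed:
  assumes H: "H \<subseteq> carrier G" and K: "subgroup K G"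
    and \<phi>: "\<And>x y. \<lbrakk>x \<in> generate G H; y \<in> generate G H\<rbrakk> \<Longrightarrow> \<phi> (x \<otimes> y) = \<phi> x \<otimes> \<phi> y"
    and closed: "\<And>x. x \<in> generate G H \<Longrightarrow> \<phi> x \<in> carrier G"
    and gens: "\<And>h. h \<in> H \<Longrightarrow> \<phi> h \<in> K"
    and x: "x \<in> generate G H"
  shows "\<phi> x \<in> K"
proof -
  have one: "\<phi> \<one> = \<one>"
    using \<phi>[OF generate.one generate.one] closed[OF generate.one] by simp
  show ?thesis
    using x
  proof induction
    case one
    then show ?case using \<open>\<phi> \<one> = \<one>\<close> subgroup.one_closed[OF K] by simp
  next
    case (incl h)
    then show ?case by (rule gens)
  next
    case (inv h)
    then have h: "h \<in> carrier G" using H by blast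
    have "\<phi> (inv h) \<otimes> \<phi> h = \<one>"
      using \<phi>[OF generate.inv generate.incl, OF inv inv] one h by simp
    then have "\<phi> (inv h) = inv (\<phi> h)"
      using closed[OF generate.inv] closed[OF generate.incl] inv
      by (metis inv_equality)
    then show ?case
      using gens[OF inv] subgroup.m_inv_closed[OF K] by simp
  next
    case (eng x y)
    then show ?case using \<phi> subgroup.m_closed[OF K] by simp
  qed
qed

locale ample_sheaf = ample \<G> for \<G> :: "'g top_groupoid" +
  fixes \<O> :: "('g, 'e) ring_gsheaf"
  assumes sheaf: "sheaf_of_rings \<G> \<O>"
begin

abbreviation E where "E \<equiv> etop \<O>"
abbreviation p where "p \<equiv> proj \<O>"
abbreviation R where "R \<equiv> stalk \<O>"
abbreviation \<alpha> where "\<alpha> \<equiv> act \<O>"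
abbreviation S where "S \<equiv> section_group \<G> \<O>"

section \<open>Stalks and the action\<close>

lemma gsheaf: "is_gsheaf \<G> \<O>"
  using sheaf by (simp add: sheaf_of_rings_def)

lemma ring_stalk: "x \<in> X \<Longrightarrow> ring (R x)"
  and one_neq_zero: "x \<in> X \<Longrightarrow> \<one>\<^bsub>R x\<^esub> \<noteq> \<zero>\<^bsub>R x\<^esub>"
  and carrier_stalk: "x \<in> X \<Longrightarrow> carrier (R x) = {e \<in> topspace E. p e = x}"
  using sheaf by (simp_all add: sheaf_of_rings_def)

lemma local_homeo_proj: "local_homeo E (unit_space \<G>) p"
  using gsheaf by (simp add: is_gsheaf_def)

lemma continuous_proj: "continuous_map E (unit_space \<G>) p"
  by (rule local_homeo_continuous[OF local_homeo_proj])

lemma proj_unit: "e \<in> topspace E \<Longrightarrow> p e \<in> X"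
  using continuous_map_in_topspace[OF continuous_proj] by simp

lemma stalk_proj: "\<lbrakk>x \<in> X; e \<in> carrier (R x)\<rbrakk> \<Longrightarrow> p e = x"
  and stalk_topspace: "\<lbrakk>x \<in> X; e \<in> carrier (R x)\<rbrakk> \<Longrightarrow> e \<in> topspace E"
  by (simp_all add: carrier_stalk)

lemma mem_stalk: "e \<in> topspace E \<Longrightarrow> e \<in> carrier (R (p e))"
  by (simp add: carrier_stalk proj_unit)

lemma act_hom: "\<gamma> \<in> A \<Longrightarrow> \<alpha> \<gamma> \<in> ring_hom (R (s \<gamma>)) (R (r \<gamma>))"
  using sheaf by (simp add: sheaf_of_rings_def)

lemma act_closed: "\<lbrakk>\<gamma> \<in> A; e \<in> carrier (R (s \<gamma>))\<rbrakk> \<Longrightarrow> \<alpha> \<gamma> e \<in> carrier (R (r \<gamma>))"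
  by (rule ring_hom_closed[OF act_hom])

lemma act_add:
  "\<lbrakk>\<gamma> \<in> A; a \<in> carrier (R (s \<gamma>)); b \<in> carrier (R (s \<gamma>))\<rbrakk>
    \<Longrightarrow> \<alpha> \<gamma> (a \<oplus>\<^bsub>R (s \<gamma>)\<^esub> b) = \<alpha> \<gamma> a \<oplus>\<^bsub>R (r \<gamma>)\<^esub> \<alpha> \<gamma> b"
  by (rule ring_hom_add[OF act_hom])

lemma act_zero: "\<gamma> \<in> A \<Longrightarrow> \<alpha> \<gamma> \<zero>\<^bsub>R (s \<gamma>)\<^esub> = \<zero>\<^bsub>R (r \<gamma>)\<^esub>"
  by (rule ring_hom_zero[OF act_hom]) (simp_all add: ring_stalk)

lemma act_unit: "\<lbrakk>x \<in> X; e \<in> carrier (R x)\<rbrakk> \<Longrightarrow> \<alpha> x e = e"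
  using gsheaf by (auto simp: is_gsheaf_def carrier_stalk)

section \<open>Continuity of the fibrewise operations\<close>

lemma continuous_add:
  assumes "continuous_map Z E f" "continuous_map Z E g" "\<And>z. z \<in> topspace Z \<Longrightarrow> p (f z) = p (g z)"
  shows "continuous_map Z E (\<lambda>z. f z \<oplus>\<^bsub>R (p (f z))\<^esub> g z)"
proof -
  have "continuous_map Z (fibre_square \<O>) (\<lambda>z. (f z, g z))"
    using assms by (auto simp: fibre_square_def continuous_map_in_subtopology continuous_map_pairedI)
  moreover have "continuous_map (fibre_square \<O>) E (\<lambda>(a, b). a \<oplus>\<^bsub>R (p a)\<^esub> b)"
    using sheaf by (simp add: sheaf_of_rings_def)
  ultimately have "continuous_map Z E ((\<lambda>(a, b). a \<oplus>\<^bsub>R (p a)\<^esub> b) \<circ> (\<lambda>z. (f z, g z)))"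
    by (rule continuous_map_compose)
  then show ?thesis by (simp add: o_def)
qed

lemma continuous_times:
  assumes "continuous_map Z E f" "continuous_map Z E g" "\<And>z. z \<in> topspace Z \<Longrightarrow> p (f z) = p (g z)"
  shows "continuous_map Z E (\<lambda>z. f z \<otimes>\<^bsub>R (p (f z))\<^esub> g z)"
proof -
  have "continuous_map Z (fibre_square \<O>) (\<lambda>z. (f z, g z))"
    using assms by (auto simp: fibre_square_def continuous_map_in_subtopology continuous_map_pairedI)
  moreover have "continuous_map (fibre_square \<O>) E (\<lambda>(a, b). a \<otimes>\<^bsub>R (p a)\<^esub> b)"
    using sheaf by (simp add: sheaf_of_rings_def)
  ultimately have "continuous_map Z E ((\<lambda>(a, b). a \<otimes>\<^bsub>R (p a)\<^esub> b) \<circ> (\<lambda>z. (f z, g z)))"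
    by (rule continuous_map_compose)
  then show ?thesis by (simp add: o_def)
qed

lemma continuous_act:
  assumes f: "continuous_map Z T f" and g: "continuous_map Z E g"
    and "\<And>z. z \<in> topspace Z \<Longrightarrow> s (f z) = p (g z)"
  shows "continuous_map Z E (\<lambda>z. \<alpha> (f z) (g z))"
proof -
  have "continuous_map Z (subtopology (prod_topology T E) (action_domain \<G> \<O>)) (\<lambda>z. (f z, g z))"
    using assms(3) continuous_map_in_topspace[OF f] continuous_map_in_topspace[OF g]
    by (auto simp: action_domain_def continuous_map_in_subtopology intro!: continuous_map_pairedI f g)
  moreover have "continuous_map (subtopology (prod_topology T E) (action_domain \<G> \<O>)) E (\<lambda>(\<gamma>, e). \<alpha> \<gamma> e)"
    using gsheaf by (simp add: is_gsheaf_def)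
  ultimately have "continuous_map Z E ((\<lambda>(\<gamma>, e). \<alpha> \<gamma> e) \<circ> (\<lambda>z. (f z, g z)))"
    by (rule continuous_map_compose)
  then show ?thesis by (simp add: o_def)
qed

lemma continuous_one: "continuous_map (unit_space \<G>) E (\<lambda>x. \<one>\<^bsub>R x\<^esub>)"
  using sheaf by (simp add: sheaf_of_rings_def)

text \<open>Near a point of agreement both maps take values in one open set on which
  \<open>p\<close> is injective, and there equal projections force equal values. Since
  \<open>E\<close> may be non-Hausdorff, agreement is open but not necessarily closed.\<close>

lemma openin_sections_agree:
  assumes f: "continuous_map Z E f" and g: "continuous_map Z E g"
    and fg: "\<And>z. z \<in> topspace Z \<Longrightarrow> p (f z) = p (g z)"
  shows "openin Z {z \<in> topspace Z. f z = g z}"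
proof (subst openin_subopen, intro ballI)
  fix z assume z: "z \<in> {z \<in> topspace Z. f z = g z}"
  then have "f z \<in> topspace E"
    using continuous_map_in_topspace[OF f] by blast
  then obtain U where U: "openin E U" "f z \<in> U" "inj_on p U"
    using local_homeo_locally_inj[OF local_homeo_proj] by blast
  let ?W = "{z \<in> topspace Z. f z \<in> U} \<inter> {z \<in> topspace Z. g z \<in> U}"
  have "openin Z ?W"
    using openin_continuous_map_preimage[OF f U(1)] openin_continuous_map_preimage[OF g U(1)] by blast
  moreover have "?W \<subseteq> {z \<in> topspace Z. f z = g z}"
    using fg U(3) by (auto dest: inj_onD)
  ultimately show "\<exists>W. openin Z W \<and> z \<in> W \<and> W \<subseteq> {z \<in> topspace Z. f z = g z}"
    using z U(2) by (intro exI[of _ ?W]) auto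
qed

text \<open>Obtained by inverting \<open>p\<close> on an open set where it is injective. It serves
  to prove continuity of zero and of negation near a point, and later to build sections over the
  units with a prescribed value.\<close>

lemma local_section:
  assumes e: "e \<in> topspace E"
  obtains K \<sigma> where "openin (unit_space \<G>) K" "compactin (unit_space \<G>) K" "p e \<in> K"
    "continuous_map (subtopology (unit_space \<G>) K) E \<sigma>" "\<And>x. x \<in> K \<Longrightarrow> \<sigma> x \<in> carrier (R x)" "\<sigma> (p e) = e"
proof -
  obtain U where U: "openin E U" "e \<in> U" "inj_on p U"
    using local_homeo_locally_inj[OF local_homeo_proj e] by blast
  have op: "openin (unit_space \<G>) (p ` U)"
    using local_homeo_open_map[OF local_homeo_proj] U(1) by (simp add: open_map_def)
  then obtain K where K: "openin (unit_space \<G>) K" "compactin (unit_space \<G>) K" "p e \<in> K" "K \<subseteq> p ` U"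
    using compact_open_unit_nbhd U(2) by blast
  have "continuous_map (subtopology (unit_space \<G>) K) E (inv_into U p)"
    using open_map_continuous_inv_into[OF local_homeo_open_map[OF local_homeo_proj] U(1,3)] K(4)
    by (rule continuous_map_from_subtopology_mono)
  moreover have "inv_into U p x \<in> carrier (R x)" if "x \<in> K" for x
  proof -
    have x: "x \<in> p ` U" using that K(4) by blast
    have "inv_into U p x \<in> topspace E"
      using inv_into_into[OF x] openin_subset[OF U(1)] by (rule subsetD[rotated])
    then show ?thesis
      using mem_stalk f_inv_into_f[OF x] by metis
  qed
  moreover have "inv_into U p (p e) = e"
    using U by simp
  ultimately show ?thesis
    using that K by blast
qed

text \<open>A local section through \<open>\<zero>\<^sub>x\<close> is idempotent for addition at \<open>x\<close>, hence near \<open>x\<close>.\<close>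

lemma continuous_zero: "continuous_map (unit_space \<G>) E (\<lambda>x. \<zero>\<^bsub>R x\<^esub>)"
proof (rule continuous_map_locally)
  fix x assume "x \<in> topspace (unit_space \<G>)"
  then have x: "x \<in> X" by simp
  have z: "\<zero>\<^bsub>R x\<^esub> \<in> topspace E" "p \<zero>\<^bsub>R x\<^esub> = x"
    using ring.ring_simprules(2)[OF ring_stalk[OF x]] by (simp_all add: carrier_stalk x)
  obtain K \<sigma> where K: "openin (unit_space \<G>) K" "x \<in> K" "continuous_map (subtopology (unit_space \<G>) K) E \<sigma>"
    "\<And>x. x \<in> K \<Longrightarrow> \<sigma> x \<in> carrier (R x)" "\<sigma> x = \<zero>\<^bsub>R x\<^esub>"
    using local_section[OF z(1)] z(2) by metis
  have KX: "K \<subseteq> X" using K(1) openin_units_iff by blast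
  have tK: "topspace (subtopology (unit_space \<G>) K) = K"
    using KX by (auto simp: topspace_subtopology)
  have pK: "p (\<sigma> y) = y" if "y \<in> K" for y
    using K(4)[OF that] that KX by (auto simp: carrier_stalk)
  let ?D = "{y \<in> K. \<sigma> y \<oplus>\<^bsub>R y\<^esub> \<sigma> y = \<sigma> y}"
  have "continuous_map (subtopology (unit_space \<G>) K) E (\<lambda>y. \<sigma> y \<oplus>\<^bsub>R y\<^esub> \<sigma> y)"
    using continuous_add[OF K(3,3)] by (rule continuous_map_eq) (use pK tK in auto)
  moreover have "p (\<sigma> y \<oplus>\<^bsub>R y\<^esub> \<sigma> y) = p (\<sigma> y)" if "y \<in> K" for y
    using ring.ring_simprules(1)[OF ring_stalk K(4) K(4)] that KX pK[OF that]
    by (auto simp: carrier_stalk)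
  ultimately have "openin (subtopology (unit_space \<G>) K) ?D"
    using openin_sections_agree[OF _ K(3)] tK by fastforce
  then have "openin (unit_space \<G>) ?D"
    using K(1) openin_trans_full by blast
  moreover have "x \<in> ?D"
    using K(2,5) ring.ring_simprules(2,8)[OF ring_stalk[OF x]] by simp
  moreover have zero: "\<sigma> y = \<zero>\<^bsub>R y\<^esub>" if "y \<in> ?D" for y
  proof -
    interpret ring "R y" using that KX ring_stalk by blast
    have "\<sigma> y \<in> carrier (R y)" "\<sigma> y \<oplus>\<^bsub>R y\<^esub> \<sigma> y = \<sigma> y"
      using that K(4) by blast+
    then show ?thesis using add.r_cancel_one by blast
  qed
  have "continuous_map (subtopology (unit_space \<G>) ?D) E \<sigma>"
    by (rule continuous_map_from_subtopology_mono[OF K(3)]) blast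
  then have "continuous_map (subtopology (unit_space \<G>) ?D) E (\<lambda>x. \<zero>\<^bsub>R x\<^esub>)"
    by (rule continuous_map_eq) (rule zero, simp only: topspace_subtopology Int_iff)
  ultimately show "\<exists>U. openin (unit_space \<G>) U \<and> x \<in> U \<and> continuous_map (subtopology (unit_space \<G>) U) E (\<lambda>x. \<zero>\<^bsub>R x\<^esub>)"
    by (intro exI[of _ ?D] conjI)
qed

text \<open>Continuity of negation is not an axiom: if \<open>\<sigma>\<close> is a local section through \<open>\<ominus> e\<close>, then
  \<open>e' \<mapsto> e' \<oplus> \<sigma> (p e')\<close> agrees with the zero section at \<open>e\<close>, hence near \<open>e\<close>.\<close>

lemma continuous_neg: "continuous_map E E (\<lambda>e. \<ominus>\<^bsub>R (p e)\<^esub> e)"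
proof (rule continuous_map_locally)
  fix e assume e: "e \<in> topspace E"
  define x where "x = p e"
  have x: "x \<in> X" and ex: "e \<in> carrier (R x)"
    using e proj_unit mem_stalk by (auto simp: x_def)
  have "\<ominus>\<^bsub>R x\<^esub> e \<in> carrier (R x)"
    using ex ring_stalk[OF x] by (simp add: ring.ring_simprules)
  then have z: "\<ominus>\<^bsub>R x\<^esub> e \<in> topspace E" "p (\<ominus>\<^bsub>R x\<^esub> e) = x"
    by (simp_all add: carrier_stalk x)
  obtain K \<sigma> where K: "openin (unit_space \<G>) K" "x \<in> K" "continuous_map (subtopology (unit_space \<G>) K) E \<sigma>"
    "\<And>x. x \<in> K \<Longrightarrow> \<sigma> x \<in> carrier (R x)" "\<sigma> x = \<ominus>\<^bsub>R x\<^esub> e"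
    using local_section[OF z(1)] z(2) by metis
  have KX: "K \<subseteq> X" using K(1) openin_units_iff by blast
  have pK: "p (\<sigma> y) = y" if "y \<in> K" for y
    using K(4)[OF that] that KX by (auto simp: carrier_stalk)
  let ?U = "{e \<in> topspace E. p e \<in> K}"
  have U: "openin E ?U"
    by (rule openin_continuous_map_preimage[OF continuous_proj K(1)])
  have tU: "topspace (subtopology E ?U) = ?U" by auto
  have cp: "continuous_map (subtopology E ?U) (unit_space \<G>) p"
    by (rule continuous_map_from_subtopology[OF continuous_proj])
  then have "continuous_map (subtopology E ?U) (subtopology (unit_space \<G>) K) p"
    by (auto simp: continuous_map_in_subtopology)
  from continuous_map_compose[OF this K(3)]
  have c\<sigma>: "continuous_map (subtopology E ?U) E (\<lambda>e. \<sigma> (p e))" by (simp add: o_def)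
  have "continuous_map (subtopology E ?U) E (\<lambda>e. id e \<oplus>\<^bsub>R (p (id e))\<^esub> \<sigma> (p e))"
    by (rule continuous_add[OF continuous_map_from_subtopology[OF continuous_map_id] c\<sigma>]) (use pK in auto)
  then have csum: "continuous_map (subtopology E ?U) E (\<lambda>e. e \<oplus>\<^bsub>R (p e)\<^esub> \<sigma> (p e))"
    by simp
  have czero: "continuous_map (subtopology E ?U) E (\<lambda>e. \<zero>\<^bsub>R (p e)\<^esub>)"
    using continuous_map_compose[OF cp continuous_zero] by (simp add: o_def)
  let ?D = "{e \<in> ?U. e \<oplus>\<^bsub>R (p e)\<^esub> \<sigma> (p e) = \<zero>\<^bsub>R (p e)\<^esub>}"
  have "p (e \<oplus>\<^bsub>R (p e)\<^esub> \<sigma> (p e)) = p \<zero>\<^bsub>R (p e)\<^esub>" if "e \<in> ?U" for e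
  proof -
    interpret ring "R (p e)" using that proj_unit ring_stalk by blast
    have "e \<oplus>\<^bsub>R (p e)\<^esub> \<sigma> (p e) \<in> carrier (R (p e))" "\<zero>\<^bsub>R (p e)\<^esub> \<in> carrier (R (p e))"
      using that K(4) mem_stalk by auto
    moreover have "p e \<in> X" using that proj_unit by blast
    ultimately show ?thesis using stalk_proj by metis
  qed
  then have "openin (subtopology E ?U) {e \<in> topspace (subtopology E ?U). e \<oplus>\<^bsub>R (p e)\<^esub> \<sigma> (p e) = \<zero>\<^bsub>R (p e)\<^esub>}"
    by (intro openin_sections_agree[OF csum czero]) (simp only: tU)
  then have "openin (subtopology E ?U) ?D"
    by (simp only: tU)
  then have "openin E ?D"
    using U openin_trans_full by blast
  moreover have "e \<in> ?D"
    using e K(2,5) ring.ring_simprules(16)[OF ring_stalk[OF x] ex] unfolding x_def by simp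
  moreover have neg: "\<sigma> (p e) = \<ominus>\<^bsub>R (p e)\<^esub> e" if "e \<in> ?D" for e
  proof -
    interpret ring "R (p e)" using that proj_unit ring_stalk by blast
    have "e \<in> carrier (R (p e))" "\<sigma> (p e) \<in> carrier (R (p e))" "e \<oplus>\<^bsub>R (p e)\<^esub> \<sigma> (p e) = \<zero>\<^bsub>R (p e)\<^esub>"
      using that K(4) mem_stalk by auto
    then show ?thesis by (metis a_comm minus_equality)
  qed
  have "continuous_map (subtopology E ?D) E (\<lambda>e. \<sigma> (p e))"
    by (rule continuous_map_from_subtopology_mono[OF c\<sigma>]) blast
  then have "continuous_map (subtopology E ?D) E (\<lambda>e. \<ominus>\<^bsub>R (p e)\<^esub> e)"
    by (rule continuous_map_eq) (rule neg, simp only: topspace_subtopology Int_iff)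
  ultimately show "\<exists>U. openin E U \<and> e \<in> U \<and> continuous_map (subtopology E U) E (\<lambda>e. \<ominus>\<^bsub>R (p e)\<^esub> e)"
    by (intro exI[of _ ?D] conjI)
qed

section \<open>The convolution ring\<close>

abbreviation zero where "zero x \<equiv> \<zero>\<^bsub>R x\<^esub>"

section \<open>The additive group of sections and supports\<close>

lemma section_carrier: "f \<in> carrier S \<longleftrightarrow> f \<in> extensional A \<and> (\<forall>\<gamma>\<in>A. f \<gamma> \<in> carrier (R (r \<gamma>)))"
  by (auto simp: section_group_def PiE_iff)

lemma section_mem: "\<lbrakk>f \<in> carrier S; \<gamma> \<in> A\<rbrakk> \<Longrightarrow> f \<gamma> \<in> carrier (R (r \<gamma>))"
  by (simp add: section_carrier)

lemma section_proj: "\<lbrakk>f \<in> carrier S; \<gamma> \<in> A\<rbrakk> \<Longrightarrow> p (f \<gamma>) = r \<gamma>"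
  using stalk_proj section_mem rng_in_units by blast

lemma section_ext: "\<lbrakk>f \<in> carrier S; g \<in> carrier S; \<And>\<gamma>. \<gamma> \<in> A \<Longrightarrow> f \<gamma> = g \<gamma>\<rbrakk> \<Longrightarrow> f = g"
  by (rule extensionalityI) (auto simp: section_carrier)

lemma stalk_add_group: "x \<in> X \<Longrightarrow> group (add_monoid (R x))"
  by (meson abelian_group.a_group ring_def ring_stalk)

lemma group_section: "group S"
  unfolding section_group_def by (rule product_group) (rule stalk_add_group, rule rng_in_units)

lemma section_mult: "\<gamma> \<in> A \<Longrightarrow> (f \<otimes>\<^bsub>S\<^esub> g) \<gamma> = f \<gamma> \<oplus>\<^bsub>R (r \<gamma>)\<^esub> g \<gamma>"
  by (simp add: section_group_def)

lemma section_one: "\<gamma> \<in> A \<Longrightarrow> \<one>\<^bsub>S\<^esub> \<gamma> = zero (r \<gamma>)"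
  by (simp add: section_group_def)

lemma section_inv: "\<lbrakk>f \<in> carrier S; \<gamma> \<in> A\<rbrakk> \<Longrightarrow> (inv\<^bsub>S\<^esub> f) \<gamma> = \<ominus>\<^bsub>R (r \<gamma>)\<^esub> f \<gamma>"
  using stalk_add_group unfolding section_group_def
  by (subst inv_product_group) (auto simp: a_inv_def)

lemma supp_iff: "\<gamma> \<in> supp \<G> \<O> f \<longleftrightarrow> \<gamma> \<in> A \<and> f \<gamma> \<noteq> zero (r \<gamma>)"
  by (simp add: supp_def)

lemma supp_one: "supp \<G> \<O> \<one>\<^bsub>S\<^esub> = {}"
  by (auto simp: supp_iff section_one)

lemma supp_mult:
  assumes "f \<in> carrier S" "g \<in> carrier S"
  shows "supp \<G> \<O> (f \<otimes>\<^bsub>S\<^esub> g) \<subseteq> supp \<G> \<O> f \<union> supp \<G> \<O> g"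
proof
  fix \<gamma> assume "\<gamma> \<in> supp \<G> \<O> (f \<otimes>\<^bsub>S\<^esub> g)"
  then have \<gamma>: "\<gamma> \<in> A" "f \<gamma> \<oplus>\<^bsub>R (r \<gamma>)\<^esub> g \<gamma> \<noteq> zero (r \<gamma>)"
    by (auto simp: supp_iff section_mult)
  interpret ring "R (r \<gamma>)" by (rule ring_stalk) (simp add: \<gamma>)
  show "\<gamma> \<in> supp \<G> \<O> f \<union> supp \<G> \<O> g"
    using \<gamma> by (auto simp: supp_iff)
qed

lemma supp_inv:
  assumes "f \<in> carrier S"
  shows "supp \<G> \<O> (inv\<^bsub>S\<^esub> f) = supp \<G> \<O> f"
proof -
  have neg: "(inv\<^bsub>S\<^esub> f) \<gamma> = zero (r \<gamma>) \<longleftrightarrow> f \<gamma> = zero (r \<gamma>)" if "\<gamma> \<in> A" for \<gamma>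
  proof -
    interpret ring "R (r \<gamma>)" by (rule ring_stalk) (simp add: that)
    show ?thesis
      unfolding section_inv[OF assms that]
      using section_mem[OF assms that] by (metis a_inv_closed l_zero r_neg r_zero zero_closed)
  qed
  show ?thesis
    unfolding supp_def by (rule Collect_cong) (use neg in blast)
qed

text \<open>The generators of \<open>Gamma_c_on\<close>, with vanishing off \<open>U\<close> recast
  as an inclusion of supports.\<close>

definition bisection_section :: "'g set \<Rightarrow> ('g \<Rightarrow> 'e) \<Rightarrow> bool" where
  "bisection_section U f \<longleftrightarrow> f \<in> carrier S \<and> compact_open_bisection \<G> U \<and>
     continuous_map (subtopology T U) E f \<and> supp \<G> \<O> f \<subseteq> U"

lemma bisection_section_iff:
  "bisection_section U f \<longleftrightarrow> f \<in> carrier S \<and> compact_open_bisection \<G> U \<and>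
     continuous_map (subtopology T U) E f \<and> (\<forall>\<gamma>\<in>A - U. f \<gamma> = zero (r \<gamma>))"
  by (auto simp: bisection_section_def supp_def)

lemma Gamma_c_on_eq: "Gamma_c_on \<G> \<O> W = generate S {f. \<exists>U. bisection_section U f \<and> U \<subseteq> W}"
  unfolding Gamma_c_on_def bisection_section_iff
  by (rule arg_cong[where f = "generate S"]) blast

lemma Gamma_c_on_gens_carrier: "{f. \<exists>U. bisection_section U f \<and> U \<subseteq> W} \<subseteq> carrier S"
  by (auto simp: bisection_section_def)

lemma Gamma_c_on_subgroup: "subgroup (Gamma_c_on \<G> \<O> W) S"
  unfolding Gamma_c_on_eq by (rule group.generate_is_subgroup[OF group_section Gamma_c_on_gens_carrier])

lemma Gamma_c_on_carrier: "f \<in> Gamma_c_on \<G> \<O> W \<Longrightarrow> f \<in> carrier S"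
  using Gamma_c_on_subgroup subgroup.subset by blast

lemma bisection_section_Gamma_c_on: "\<lbrakk>bisection_section U f; U \<subseteq> W\<rbrakk> \<Longrightarrow> f \<in> Gamma_c_on \<G> \<O> W"
  unfolding Gamma_c_on_eq by (rule generate.incl) blast

lemma bisection_section_subset: "bisection_section U f \<Longrightarrow> U \<subseteq> A"
  by (auto simp: bisection_section_def compact_open_bisection_def bisection_def)

text \<open>A factorization of \<gamma> is determined by its left factor, whose range is
  \<open>r \<gamma>\<close>. Finiteness of the support over each range therefore makes convolution
  sums finite. Elements of \<open>Gamma_c_on\<close> have it because a generator has at most one
  arrow over each unit.\<close>

definition fibre_finite :: "('g \<Rightarrow> 'e) \<Rightarrow> bool" where
  "fibre_finite f \<longleftrightarrow> (\<forall>x. finite {\<beta> \<in> supp \<G> \<O> f. r \<beta> = x})"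

lemma fibre_finite_mono:
  assumes "fibre_finite g" "fibre_finite h" "supp \<G> \<O> f \<subseteq> supp \<G> \<O> g \<union> supp \<G> \<O> h"
  shows "fibre_finite f"
  unfolding fibre_finite_def
proof
  fix x
  have "{\<beta> \<in> supp \<G> \<O> f. r \<beta> = x} \<subseteq> {\<beta> \<in> supp \<G> \<O> g. r \<beta> = x} \<union> {\<beta> \<in> supp \<G> \<O> h. r \<beta> = x}"
    using assms(3) by blast
  then show "finite {\<beta> \<in> supp \<G> \<O> f. r \<beta> = x}"
    by (rule finite_subset) (use assms(1,2) in \<open>simp add: fibre_finite_def\<close>)
qed

lemma bisection_section_fibre_finite:
  assumes "bisection_section U f"
  shows "fibre_finite f"
  unfolding fibre_finite_def
proof
  fix x
  have inj: "inj_on r U" and sub: "supp \<G> \<O> f \<subseteq> U"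
    using assms by (auto simp: bisection_section_def compact_open_bisection_def bisection_def)
  have "{\<beta> \<in> supp \<G> \<O> f. r \<beta> = x} \<subseteq> {inv_into U r x}"
    using inj sub by auto
  then show "finite {\<beta> \<in> supp \<G> \<O> f. r \<beta> = x}"
    by (rule finite_subset) simp
qed

lemma Gamma_c_on_fibre_finite:
  assumes "f \<in> Gamma_c_on \<G> \<O> W"
  shows "fibre_finite f"
  using assms unfolding Gamma_c_on_eq
proof induction
  case one
  then show ?case by (simp add: fibre_finite_def supp_one)
next
  case (incl f)
  then show ?case using bisection_section_fibre_finite by blast
next
  case (inv f)
  then have "f \<in> carrier S" "fibre_finite f"
    using bisection_section_fibre_finite by (auto simp: bisection_section_def)
  then show ?case
    using fibre_finite_mono[of f f] by (simp add: supp_inv)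
next
  case (eng f g)
  then show ?case
    using fibre_finite_mono[of f g] supp_mult Gamma_c_on_carrier unfolding Gamma_c_on_eq by blast
qed

section \<open>Factorizations and evaluation of convolutions\<close>

definition factorizations :: "'g \<Rightarrow> ('g \<times> 'g) set" where
  "factorizations \<gamma> = {q \<in> composable \<G>. fst q \<cdot> snd q = \<gamma>}"

lemma factorizations_iff:
  "(\<beta>, \<rho>) \<in> factorizations \<gamma> \<longleftrightarrow> \<beta> \<in> A \<and> \<rho> \<in> A \<and> s \<beta> = r \<rho> \<and> \<beta> \<cdot> \<rho> = \<gamma>"
  by (auto simp: factorizations_def composable_iff)

lemma factorizations_rng: "(\<beta>, \<rho>) \<in> factorizations \<gamma> \<Longrightarrow> r \<beta> = r \<gamma>"
  by (auto simp: factorizations_iff)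

text \<open>The stalk is read off from the left factor, not from the product, so that the term does
  not mention \<gamma>. On factorizations of \<gamma> it agrees with the term in
  \<open>conv\<close>, because \<open>r \<beta> = r \<gamma>\<close>.\<close>

definition summand :: "('g \<Rightarrow> 'e) \<Rightarrow> ('g \<Rightarrow> 'e) \<Rightarrow> 'g \<times> 'g \<Rightarrow> 'e" where
  "summand f g q = f (fst q) \<otimes>\<^bsub>R (r (fst q))\<^esub> \<alpha> (fst q) (g (snd q))"

lemma summand_closed:
  assumes "f \<in> carrier S" "g \<in> carrier S" "q \<in> factorizations \<gamma>"
  shows "summand f g q \<in> carrier (R (r \<gamma>))"
proof -
  obtain \<beta> \<rho> where q: "q = (\<beta>, \<rho>)" by force
  then have *: "\<beta> \<in> A" "\<rho> \<in> A" "s \<beta> = r \<rho>" "r \<beta> = r \<gamma>"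
    using assms(3) factorizations_rng by (auto simp: factorizations_iff)
  then have "\<alpha> \<beta> (g \<rho>) \<in> carrier (R (r \<beta>))"
    using act_closed section_mem[OF assms(2)] by metis
  moreover have "f \<beta> \<in> carrier (R (r \<beta>))"
    using section_mem[OF assms(1)] * by blast
  ultimately show ?thesis
    using *(4) ring.ring_simprules(5)[OF ring_stalk[OF rng_in_units[OF *(1)]]] by (simp add: summand_def q)
qed

lemma summand_nonzero:
  assumes "f \<in> carrier S" "g \<in> carrier S" "(\<beta>, \<rho>) \<in> factorizations \<gamma>"
    and "summand f g (\<beta>, \<rho>) \<noteq> zero (r \<gamma>)"
  shows "\<beta> \<in> supp \<G> \<O> f" "\<rho> \<in> supp \<G> \<O> g"
proof -
  have *: "\<beta> \<in> A" "\<rho> \<in> A" "s \<beta> = r \<rho>" "r \<beta> = r \<gamma>"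
    using assms(3) factorizations_rng by (auto simp: factorizations_iff)
  interpret ring "R (r \<gamma>)" using ring_stalk rng_in_units[OF *(1)] *(4) by simp
  have m: "f \<beta> \<in> carrier (R (r \<gamma>))" "\<alpha> \<beta> (g \<rho>) \<in> carrier (R (r \<gamma>))"
    using section_mem[OF assms(1)] section_mem[OF assms(2)] act_closed * by metis+
  have "f \<beta> \<noteq> zero (r \<beta>)"
    using assms(4) m * by (auto simp: summand_def)
  then show "\<beta> \<in> supp \<G> \<O> f"
    using * by (simp add: supp_iff)
  have "g \<rho> \<noteq> zero (r \<rho>)"
    using assms(4) m * act_zero[of \<beta>] by (auto simp: summand_def)
  then show "\<rho> \<in> supp \<G> \<O> g"
    using * by (simp add: supp_iff)
qed

lemma conv_eq:
  assumes "f \<in> carrier S" "g \<in> carrier S" and \<gamma>: "\<gamma> \<in> A"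
  shows "conv \<G> \<O> f g \<gamma> =
    finsum (R (r \<gamma>)) (summand f g) {q \<in> factorizations \<gamma>. summand f g q \<noteq> zero (r \<gamma>)}"
proof -
  interpret ring "R (r \<gamma>)" by (rule ring_stalk) (simp add: \<gamma>)
  let ?t = "\<lambda>(\<beta>, \<rho>). f \<beta> \<otimes>\<^bsub>R (r \<gamma>)\<^esub> \<alpha> \<beta> (g \<rho>)"
  have t: "?t q = summand f g q" if "q \<in> factorizations \<gamma>" for q
    using that factorizations_rng by (cases q) (auto simp: summand_def)
  have set: "{q \<in> composable \<G>. fst q \<cdot> snd q = \<gamma> \<and> ?t q \<noteq> zero (r \<gamma>)} =
    {q \<in> factorizations \<gamma>. summand f g q \<noteq> zero (r \<gamma>)}"
    using t by (auto simp: factorizations_def)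
  have "conv \<G> \<O> f g \<gamma> = finsum (R (r \<gamma>)) ?t {q \<in> composable \<G>. fst q \<cdot> snd q = \<gamma> \<and> ?t q \<noteq> zero (r \<gamma>)}"
    using \<gamma> by (simp add: conv_def Let_def)
  also have "\<dots> = finsum (R (r \<gamma>)) (summand f g) {q \<in> factorizations \<gamma>. summand f g q \<noteq> zero (r \<gamma>)}"
    unfolding set
    by (rule finsum_cong') (use t summand_closed[OF assms(1,2)] in auto)
  finally show ?thesis .
qed

text \<open>\<open>conv\<close> sums over the nonzero terms, a set that changes with
  \<open>f\<close> and \<open>g\<close>. Padding with zero terms allows several convolutions to be
  compared over one index set.\<close>

lemma conv_eq_finite:
  assumes fg: "f \<in> carrier S" "g \<in> carrier S" and \<gamma>: "\<gamma> \<in> A"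
    and B: "finite B" "B \<subseteq> factorizations \<gamma>"
      "\<And>q. \<lbrakk>q \<in> factorizations \<gamma>; summand f g q \<noteq> zero (r \<gamma>)\<rbrakk> \<Longrightarrow> q \<in> B"
  shows "conv \<G> \<O> f g \<gamma> = finsum (R (r \<gamma>)) (summand f g) B"
proof -
  interpret ring "R (r \<gamma>)" by (rule ring_stalk) (simp add: \<gamma>)
  show ?thesis
    unfolding conv_eq[OF fg \<gamma>]
    by (rule add.finprod_mono_neutral_cong_left) (use B summand_closed[OF fg] in auto)
qed

text \<open>Covers both situations in which the sum collapses: a left factor supported in a
  bisection, and a factor supported in the unit space.\<close>

lemma conv_eq_summand:
  assumes fg: "f \<in> carrier S" "g \<in> carrier S" and \<gamma>: "\<gamma> \<in> A"
    and q: "q \<in> factorizations \<gamma>"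
      "\<And>q'. \<lbrakk>q' \<in> factorizations \<gamma>; summand f g q' \<noteq> zero (r \<gamma>)\<rbrakk> \<Longrightarrow> q' = q"
  shows "conv \<G> \<O> f g \<gamma> = summand f g q"
proof -
  interpret ring "R (r \<gamma>)" by (rule ring_stalk) (simp add: \<gamma>)
  have "conv \<G> \<O> f g \<gamma> = finsum (R (r \<gamma>)) (summand f g) {q}"
    by (rule conv_eq_finite[OF fg \<gamma>]) (use q in auto)
  also have "\<dots> = summand f g q"
    using finsum_insert[of "{}" q "summand f g"] summand_closed[OF fg q(1)] by simp
  finally show ?thesis .
qed

lemma conv_closed:
  assumes fg: "f \<in> carrier S" "g \<in> carrier S"
  shows "conv \<G> \<O> f g \<in> carrier S"
proof -
  have "conv \<G> \<O> f g \<gamma> \<in> carrier (R (r \<gamma>))" if \<gamma>: "\<gamma> \<in> A" for \<gamma>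
  proof -
    interpret ring "R (r \<gamma>)" by (rule ring_stalk) (simp add: \<gamma>)
    show ?thesis
      unfolding conv_eq[OF fg \<gamma>] by (rule finsum_closed) (use summand_closed[OF fg] in auto)
  qed
  then show ?thesis
    by (simp add: section_carrier conv_def)
qed

lemma conv_supp:
  assumes fg: "f \<in> carrier S" "g \<in> carrier S" and "\<gamma> \<in> supp \<G> \<O> (conv \<G> \<O> f g)"
  obtains \<beta> \<rho> where "\<beta> \<in> supp \<G> \<O> f" "\<rho> \<in> supp \<G> \<O> g" "s \<beta> = r \<rho>" "\<gamma> = \<beta> \<cdot> \<rho>"
proof -
  have \<gamma>: "\<gamma> \<in> A" "conv \<G> \<O> f g \<gamma> \<noteq> zero (r \<gamma>)"
    using assms(3) by (auto simp: supp_iff)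
  interpret ring "R (r \<gamma>)" by (rule ring_stalk) (simp add: \<gamma>)
  have "{q \<in> factorizations \<gamma>. summand f g q \<noteq> zero (r \<gamma>)} \<noteq> {}"
    using \<gamma>(2) unfolding conv_eq[OF fg \<gamma>(1)] by (metis finsum_empty)
  then obtain \<beta> \<rho> where q: "(\<beta>, \<rho>) \<in> factorizations \<gamma>" "summand f g (\<beta>, \<rho>) \<noteq> zero (r \<gamma>)"
    by auto
  show ?thesis
    by (rule that[OF summand_nonzero[OF fg q]]) (use q(1) in \<open>auto simp: factorizations_iff\<close>)
qed

text \<open>The right factor is forced to be \<open>iv \<beta> \<cdot> \<gamma>\<close>, so the
  contributing factorizations are indexed by arrows of the support of \<open>f\<close> with range
  \<open>r \<gamma>\<close>.\<close>

lemma finite_summands: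
  assumes fg: "f \<in> carrier S" "g \<in> carrier S" and f: "fibre_finite f"
  shows "finite {q \<in> factorizations \<gamma>. summand f g q \<noteq> zero (r \<gamma>)}"
proof (rule finite_subset)
  show "{q \<in> factorizations \<gamma>. summand f g q \<noteq> zero (r \<gamma>)} \<subseteq>
    (\<lambda>\<beta>. (\<beta>, iv \<beta> \<cdot> \<gamma>)) ` {\<beta> \<in> supp \<G> \<O> f. r \<beta> = r \<gamma>}"
  proof
    fix q assume q: "q \<in> {q \<in> factorizations \<gamma>. summand f g q \<noteq> zero (r \<gamma>)}"
    obtain \<beta> \<rho> where [simp]: "q = (\<beta>, \<rho>)" by force
    have "\<beta> \<in> supp \<G> \<O> f" using q summand_nonzero[OF fg] by auto
    moreover have "r \<beta> = r \<gamma>" using q factorizations_rng by auto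
    moreover have "\<rho> = iv \<beta> \<cdot> \<gamma>" using q by (auto simp: factorizations_iff inv_mult_cancel)
    ultimately show "q \<in> (\<lambda>\<beta>. (\<beta>, iv \<beta> \<cdot> \<gamma>)) ` {\<beta> \<in> supp \<G> \<O> f. r \<beta> = r \<gamma>}"
      by auto
  qed
qed (use f in \<open>simp add: fibre_finite_def\<close>)

section \<open>Biadditivity and closure under convolution\<close>

lemma conv_add_left:
  assumes f: "f \<in> carrier S" "fibre_finite f" and f': "f' \<in> carrier S" "fibre_finite f'"
    and g: "g \<in> carrier S"
  shows "conv \<G> \<O> (f \<otimes>\<^bsub>S\<^esub> f') g = conv \<G> \<O> f g \<otimes>\<^bsub>S\<^esub> conv \<G> \<O> f' g"
proof (rule section_ext)
  interpret S: group S by (rule group_section)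
  show "conv \<G> \<O> (f \<otimes>\<^bsub>S\<^esub> f') g \<in> carrier S" "conv \<G> \<O> f g \<otimes>\<^bsub>S\<^esub> conv \<G> \<O> f' g \<in> carrier S"
    using f(1) f'(1) g by (simp_all add: conv_closed)
  fix \<gamma> assume \<gamma>: "\<gamma> \<in> A"
  interpret ring "R (r \<gamma>)" by (rule ring_stalk) (simp add: \<gamma>)
  let ?N = "\<lambda>f. {q \<in> factorizations \<gamma>. summand f g q \<noteq> zero (r \<gamma>)}"
  \<comment> \<open>A common index set: a term of the sum section is the sum of the two terms, so it
    can be nonzero only if one of them is.\<close>
  let ?B = "?N f \<union> ?N f'"
  have B: "finite ?B" using finite_summands f f' g by blast
  have sum: "summand (f \<otimes>\<^bsub>S\<^esub> f') g q = summand f g q \<oplus>\<^bsub>R (r \<gamma>)\<^esub> summand f' g q"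
    if "q \<in> factorizations \<gamma>" for q
  proof -
    obtain \<beta> \<rho> where q: "q = (\<beta>, \<rho>)" by force
    then have *: "\<beta> \<in> A" "\<rho> \<in> A" "s \<beta> = r \<rho>" "r \<beta> = r \<gamma>"
      using that factorizations_rng by (auto simp: factorizations_iff)
    have "f \<beta> \<in> carrier (R (r \<gamma>))" "f' \<beta> \<in> carrier (R (r \<gamma>))" "\<alpha> \<beta> (g \<rho>) \<in> carrier (R (r \<gamma>))"
      using section_mem[OF f(1)] section_mem[OF f'(1)] section_mem[OF g] act_closed * by metis+
    then show ?thesis
      using * by (simp add: q summand_def section_mult l_distr)
  qed
  have "conv \<G> \<O> (f \<otimes>\<^bsub>S\<^esub> f') g \<gamma> = finsum (R (r \<gamma>)) (summand (f \<otimes>\<^bsub>S\<^esub> f') g) ?B"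
    by (rule conv_eq_finite) (use f f' g \<gamma> B sum in auto)
  also have "\<dots> = finsum (R (r \<gamma>)) (\<lambda>q. summand f g q \<oplus>\<^bsub>R (r \<gamma>)\<^esub> summand f' g q) ?B"
    by (rule finsum_cong') (use sum summand_closed f(1) f'(1) g in auto)
  also have "\<dots> = finsum (R (r \<gamma>)) (summand f g) ?B \<oplus>\<^bsub>R (r \<gamma>)\<^esub> finsum (R (r \<gamma>)) (summand f' g) ?B"
    by (rule finsum_addf) (use summand_closed f(1) f'(1) g in auto)
  also have "finsum (R (r \<gamma>)) (summand f g) ?B = conv \<G> \<O> f g \<gamma>"
    by (rule conv_eq_finite[symmetric]) (use f g \<gamma> B in auto)
  also have "finsum (R (r \<gamma>)) (summand f' g) ?B = conv \<G> \<O> f' g \<gamma>"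
    by (rule conv_eq_finite[symmetric]) (use f' g \<gamma> B in auto)
  finally show "conv \<G> \<O> (f \<otimes>\<^bsub>S\<^esub> f') g \<gamma> = (conv \<G> \<O> f g \<otimes>\<^bsub>S\<^esub> conv \<G> \<O> f' g) \<gamma>"
    by (simp add: section_mult \<gamma>)
qed

lemma conv_add_right:
  assumes f: "f \<in> carrier S" "fibre_finite f" and g: "g \<in> carrier S" and g': "g' \<in> carrier S"
  shows "conv \<G> \<O> f (g \<otimes>\<^bsub>S\<^esub> g') = conv \<G> \<O> f g \<otimes>\<^bsub>S\<^esub> conv \<G> \<O> f g'"
proof (rule section_ext)
  interpret S: group S by (rule group_section)
  show "conv \<G> \<O> f (g \<otimes>\<^bsub>S\<^esub> g') \<in> carrier S" "conv \<G> \<O> f g \<otimes>\<^bsub>S\<^esub> conv \<G> \<O> f g' \<in> carrier S"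
    using f(1) g g' by (simp_all add: conv_closed)
  fix \<gamma> assume \<gamma>: "\<gamma> \<in> A"
  interpret ring "R (r \<gamma>)" by (rule ring_stalk) (simp add: \<gamma>)
  let ?N = "\<lambda>g. {q \<in> factorizations \<gamma>. summand f g q \<noteq> zero (r \<gamma>)}"
  let ?B = "?N g \<union> ?N g'"
  have B: "finite ?B" using finite_summands f g g' by blast
  have sum: "summand f (g \<otimes>\<^bsub>S\<^esub> g') q = summand f g q \<oplus>\<^bsub>R (r \<gamma>)\<^esub> summand f g' q"
    if "q \<in> factorizations \<gamma>" for q
  proof -
    obtain \<beta> \<rho> where q: "q = (\<beta>, \<rho>)" by force
    then have *: "\<beta> \<in> A" "\<rho> \<in> A" "s \<beta> = r \<rho>" "r \<beta> = r \<gamma>"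
      using that factorizations_rng by (auto simp: factorizations_iff)
    have "f \<beta> \<in> carrier (R (r \<gamma>))" "\<alpha> \<beta> (g \<rho>) \<in> carrier (R (r \<gamma>))" "\<alpha> \<beta> (g' \<rho>) \<in> carrier (R (r \<gamma>))"
      using section_mem[OF f(1)] section_mem[OF g] section_mem[OF g'] act_closed * by metis+
    \<comment> \<open>Here the arrow \<beta> must act additively. The values of \<open>g\<close> and
      \<open>g'\<close> at \<rho> lie in the stalk at \<open>r \<rho>\<close>, which is the stalk at
      \<open>s \<beta>\<close> on which \<beta> acts.\<close>
    moreover have "\<alpha> \<beta> (g \<rho> \<oplus>\<^bsub>R (r \<rho>)\<^esub> g' \<rho>) = \<alpha> \<beta> (g \<rho>) \<oplus>\<^bsub>R (r \<gamma>)\<^esub> \<alpha> \<beta> (g' \<rho>)"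
      using act_add[of \<beta> "g \<rho>" "g' \<rho>"] section_mem[OF g] section_mem[OF g'] * by simp
    ultimately show ?thesis
      using * by (simp add: q summand_def section_mult r_distr)
  qed
  have "conv \<G> \<O> f (g \<otimes>\<^bsub>S\<^esub> g') \<gamma> = finsum (R (r \<gamma>)) (summand f (g \<otimes>\<^bsub>S\<^esub> g')) ?B"
    by (rule conv_eq_finite) (use f g g' \<gamma> B sum in auto)
  also have "\<dots> = finsum (R (r \<gamma>)) (\<lambda>q. summand f g q \<oplus>\<^bsub>R (r \<gamma>)\<^esub> summand f g' q) ?B"
    by (rule finsum_cong') (use sum summand_closed f(1) g g' in auto)
  also have "\<dots> = finsum (R (r \<gamma>)) (summand f g) ?B \<oplus>\<^bsub>R (r \<gamma>)\<^esub> finsum (R (r \<gamma>)) (summand f g') ?B"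
    by (rule finsum_addf) (use summand_closed f(1) g g' in auto)
  also have "finsum (R (r \<gamma>)) (summand f g) ?B = conv \<G> \<O> f g \<gamma>"
    by (rule conv_eq_finite[symmetric]) (use f g \<gamma> B in auto)
  also have "finsum (R (r \<gamma>)) (summand f g') ?B = conv \<G> \<O> f g' \<gamma>"
    by (rule conv_eq_finite[symmetric]) (use f g' \<gamma> B in auto)
  finally show "conv \<G> \<O> f (g \<otimes>\<^bsub>S\<^esub> g') \<gamma> = (conv \<G> \<O> f g \<otimes>\<^bsub>S\<^esub> conv \<G> \<O> f g') \<gamma>"
    by (simp add: section_mult \<gamma>)
qed

text \<open>Over a product bisection only one factorization contributes. The convolution is then a
  composite of the factor maps, \<open>f\<close>, \<open>g\<close>, the action and multiplication in
  the stalks, all of them continuous.\<close>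

lemma bisection_section_conv:
  assumes f: "bisection_section U f" and g: "bisection_section V g"
  shows "bisection_section (set_mult U V) (conv \<G> \<O> f g)"
proof -
  have fS: "f \<in> carrier S" and U: "compact_open_bisection \<G> U" and fc: "continuous_map (subtopology T U) E f"
    and fU: "supp \<G> \<O> f \<subseteq> U"
    using f by (auto simp: bisection_section_def)
  have gS: "g \<in> carrier S" and V: "compact_open_bisection \<G> V" and gc: "continuous_map (subtopology T V) E g"
    and gV: "supp \<G> \<O> g \<subseteq> V"
    using g by (auto simp: bisection_section_def)
  have UA: "U \<subseteq> A" "inj_on r U" and VA: "V \<subseteq> A"
    using U V by (auto simp: compact_open_bisection_def bisection_def)
  let ?W = "set_mult U V"
  let ?L = "\<lambda>w. inv_into U r (r w)"
  let ?N = "\<lambda>w. iv (?L w) \<cdot> w"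
  have W: "compact_open_bisection \<G> ?W"
    by (rule compact_open_bisection_mult[OF U V])
  have WA: "w \<in> A" "r w \<in> r ` U" "?N w \<in> V" "?L w \<in> U" "r (?L w) = r w" if "w \<in> ?W" for w
    using that set_mult_eq[OF U VA] inv_into_into[of "r w" r U] f_inv_into_f[of "r w" r U] by auto
  have tW: "topspace (subtopology T ?W) = ?W"
    using WA(1) by auto
  \<comment> \<open>The left factor of a nonzero term lies in \<open>U\<close> and has range
    \<open>r w\<close>, so it is \<open>?L w\<close>. The stalk is written through \<open>p\<close>
    to match the form in which fibrewise multiplication is continuous.\<close>
  have val: "conv \<G> \<O> f g w = f (?L w) \<otimes>\<^bsub>R (p (f (?L w)))\<^esub> \<alpha> (?L w) (g (?N w))" if w: "w \<in> ?W" for w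
  proof -
    have LA: "?L w \<in> A" using WA(4)[OF w] UA by blast
    have "conv \<G> \<O> f g w = summand f g (?L w, ?N w)"
    proof (rule conv_eq_summand[OF fS gS WA(1)[OF w]])
      show "(?L w, ?N w) \<in> factorizations w"
        using LA WA[OF w] mult_inv_cancel[OF LA WA(1)[OF w]] by (auto simp: factorizations_iff)
      fix q assume q: "q \<in> factorizations w" "summand f g q \<noteq> zero (r w)"
      obtain \<beta> \<rho> where [simp]: "q = (\<beta>, \<rho>)" by force
      have "\<beta> \<in> U" using q summand_nonzero[OF fS gS] fU by auto
      moreover have "r \<beta> = r w" using q factorizations_rng by auto
      ultimately have "\<beta> = ?L w" using UA(2) by (metis inv_into_f_f)
      moreover have "\<rho> = iv \<beta> \<cdot> w" using q by (auto simp: factorizations_iff inv_mult_cancel)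
      ultimately show "q = (?L w, ?N w)" by simp
    qed
    then show ?thesis
      using section_proj[OF fS LA] by (simp add: summand_def)
  qed
  have cid: "continuous_map (subtopology T ?W) T (\<lambda>w. w)"
    by (simp add: continuous_map_from_subtopology)
  have cL: "continuous_map (subtopology T ?W) T ?L"
    by (rule continuous_left_factor[OF U cid]) (use WA in auto)
  have cN: "continuous_map (subtopology T ?W) T ?N"
    by (rule continuous_right_factor[OF U cid]) (use WA in auto)
  have "continuous_map (subtopology T ?W) (subtopology T U) ?L"
    using cL WA by (simp add: continuous_map_in_subtopology image_subset_iff)
  from continuous_map_compose[OF this fc]
  have cfL: "continuous_map (subtopology T ?W) E (\<lambda>w. f (?L w))" by (simp add: o_def)
  have "continuous_map (subtopology T ?W) (subtopology T V) ?N"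
    using cN WA by (simp add: continuous_map_in_subtopology image_subset_iff)
  from continuous_map_compose[OF this gc]
  have cgN: "continuous_map (subtopology T ?W) E (\<lambda>w. g (?N w))" by (simp add: o_def)
  have LN: "s (?L w) = p (g (?N w))" "p (f (?L w)) = p (\<alpha> (?L w) (g (?N w)))" if w: "w \<in> ?W" for w
  proof -
    have *: "?L w \<in> A" "w \<in> A" "?N w \<in> A" using WA[OF w] UA VA by auto
    then have N: "r (?N w) = s (?L w)" using WA[OF w] by simp
    then show "s (?L w) = p (g (?N w))" using section_proj[OF gS *(3)] by simp
    have "\<alpha> (?L w) (g (?N w)) \<in> carrier (R (r (?L w)))"
      using act_closed[OF *(1)] section_mem[OF gS *(3)] unfolding N by blast
    then show "p (f (?L w)) = p (\<alpha> (?L w) (g (?N w)))"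
      using section_proj[OF fS *(1)] stalk_proj[OF rng_in_units[OF *(1)]] by simp
  qed
  have "continuous_map (subtopology T ?W) E (\<lambda>w. \<alpha> (?L w) (g (?N w)))"
    by (rule continuous_act[OF cL cgN]) (use LN tW in simp)
  then have "continuous_map (subtopology T ?W) E (\<lambda>w. f (?L w) \<otimes>\<^bsub>R (p (f (?L w)))\<^esub> \<alpha> (?L w) (g (?N w)))"
    by (rule continuous_times[OF cfL]) (use LN(2) tW in blast)
  then have "continuous_map (subtopology T ?W) E (conv \<G> \<O> f g)"
    by (rule continuous_map_eq) (use val tW in simp)
  moreover have "supp \<G> \<O> (conv \<G> \<O> f g) \<subseteq> ?W"
  proof
    fix w assume "w \<in> supp \<G> \<O> (conv \<G> \<O> f g)"
    then obtain \<beta> \<rho> where "\<beta> \<in> supp \<G> \<O> f" "\<rho> \<in> supp \<G> \<O> g" "s \<beta> = r \<rho>" "w = \<beta> \<cdot> \<rho>"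
      by (rule conv_supp[OF fS gS])
    then show "w \<in> ?W"
      using fU gV unfolding set_mult_def by blast
  qed
  ultimately show ?thesis
    using conv_closed[OF fS gS] W by (simp add: bisection_section_def)
qed

text \<open>Biadditivity extends the case of two generators one argument at a time: the left
  argument with a generator on the right, then the right argument with \<open>f\<close>
  fixed.\<close>

lemma Gamma_c_conv_closed:
  assumes f: "f \<in> Gamma_c \<G> \<O>" and g: "g \<in> Gamma_c \<G> \<O>"
  shows "conv \<G> \<O> f g \<in> Gamma_c \<G> \<O>"
proof -
  interpret S: group S by (rule group_section)
  let ?H = "{f. \<exists>U. bisection_section U f \<and> U \<subseteq> A}"
  have \<Gamma>: "Gamma_c \<G> \<O> = generate S ?H"
    by (simp add: Gamma_c_def Gamma_c_on_eq)
  have K: "subgroup (Gamma_c \<G> \<O>) S"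
    unfolding Gamma_c_def by (rule Gamma_c_on_subgroup)
  have carr: "h \<in> carrier S" "fibre_finite h" if "h \<in> generate S ?H" for h
    using that Gamma_c_on_carrier Gamma_c_on_fibre_finite unfolding Gamma_c_on_eq by blast+
  have inH: "h \<in> generate S ?H" if "h \<in> ?H" for h
    using that by (rule generate.incl)
  have left: "conv \<G> \<O> f h \<in> Gamma_c \<G> \<O>" if h: "h \<in> ?H" for h
  proof (rule S.generate_hom_closed[where \<phi> = "\<lambda>f. conv \<G> \<O> f h", OF Gamma_c_on_gens_carrier[of A] K])
    have hS: "h \<in> carrier S" using h by (auto simp: bisection_section_def)
    show "conv \<G> \<O> (x \<otimes>\<^bsub>S\<^esub> y) h = conv \<G> \<O> x h \<otimes>\<^bsub>S\<^esub> conv \<G> \<O> y h"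
      if "x \<in> generate S ?H" "y \<in> generate S ?H" for x y
      using conv_add_left carr that hS by blast
    show "conv \<G> \<O> x h \<in> carrier S" if "x \<in> generate S ?H" for x
      using conv_closed carr that hS by blast
    show "conv \<G> \<O> k h \<in> Gamma_c \<G> \<O>" if "k \<in> ?H" for k
    proof -
      obtain U V where "bisection_section U k" "bisection_section V h"
        using \<open>k \<in> ?H\<close> h by blast
      then have "bisection_section (set_mult U V) (conv \<G> \<O> k h)"
        by (rule bisection_section_conv)
      then show ?thesis
        unfolding Gamma_c_def by (intro bisection_section_Gamma_c_on bisection_section_subset)
    qed
    show "f \<in> generate S ?H" using f \<Gamma> by blast
  qed
  show ?thesis
  proof (rule S.generate_hom_closed[where \<phi> = "conv \<G> \<O> f", OF Gamma_c_on_gens_carrier[of A] K])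
    have fS: "f \<in> carrier S" "fibre_finite f" using f \<Gamma> carr by blast+
    show "conv \<G> \<O> f (x \<otimes>\<^bsub>S\<^esub> y) = conv \<G> \<O> f x \<otimes>\<^bsub>S\<^esub> conv \<G> \<O> f y"
      if "x \<in> generate S ?H" "y \<in> generate S ?H" for x y
      using conv_add_right[OF fS] carr that by blast
    show "conv \<G> \<O> f x \<in> carrier S" if "x \<in> generate S ?H" for x
      using conv_closed carr that fS by blast
    show "g \<in> generate S ?H" using g \<Gamma> by blast
  qed (rule left)
qed

section \<open>Sections over the unit space\<close>

lemma openin_zeros:
  assumes f: "f \<in> carrier S" "continuous_map (unit_space \<G>) E f"
  shows "openin (unit_space \<G>) {x \<in> X. f x = zero x}"
proof -
  have "p (f x) = p (zero x)" if "x \<in> X" for x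
  proof -
    have "p (f x) = x"
      using section_proj[OF f(1), of x] that by simp
    moreover have "p (zero x) = x"
      using stalk_proj that ring.ring_simprules(2)[OF ring_stalk[OF that]] by blast
    ultimately show ?thesis by simp
  qed
  then show ?thesis
    using openin_sections_agree[OF f(2) continuous_zero] unfolding topspace_units by simp
qed

text \<open>The zero set is where two continuous sections agree, hence open. So the set of nonzero
  points is closed without taking a closure.\<close>

lemma closedin_unit_supp:
  assumes f: "f \<in> carrier S" "continuous_map (unit_space \<G>) E f" "supp \<G> \<O> f \<subseteq> X"
  shows "closedin (unit_space \<G>) (supp \<G> \<O> f)"
proof -
  have "X - supp \<G> \<O> f = {x \<in> X. f x = zero x}"
    by (auto simp: supp_iff)
  then show ?thesis
    using openin_zeros[OF f(1,2)] f(3) unfolding closedin_def topspace_units by simp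
qed

lemma Gamma_c_units_iff:
  "f \<in> Gamma_c_units \<G> \<O> \<longleftrightarrow> f \<in> carrier S \<and> continuous_map (unit_space \<G>) E f \<and>
     compactin (unit_space \<G>) (supp \<G> \<O> f) \<and> supp \<G> \<O> f \<subseteq> X"
proof -
  have "{x \<in> X. f x \<noteq> zero x} = supp \<G> \<O> f" if "supp \<G> \<O> f \<subseteq> X"
    using that by (auto simp: supp_iff)
  moreover have "(\<forall>\<gamma>\<in>A - X. f \<gamma> = zero (r \<gamma>)) \<longleftrightarrow> supp \<G> \<O> f \<subseteq> X"
    by (auto simp: supp_iff)
  ultimately show ?thesis
    unfolding Gamma_c_units_def compact_Hausdorff_in_def
    using Hausdorff_space_subtopology[OF Hausdorff_units] by auto
qed

text \<open>The support is closed in the unit space, so lying inside a compact set already makes it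
  compact. Such a containment passes easily to sums, inverses and convolutions.\<close>

lemma Gamma_c_units_I:
  assumes f: "f \<in> carrier S" "continuous_map (unit_space \<G>) E f" "supp \<G> \<O> f \<subseteq> K"
    and K: "compactin (unit_space \<G>) K"
  shows "f \<in> Gamma_c_units \<G> \<O>"
proof -
  have X: "supp \<G> \<O> f \<subseteq> X"
    using f(3) compactin_subset_topspace[OF K] unfolding topspace_units by (rule order_trans)
  show ?thesis
    unfolding Gamma_c_units_iff
    using f X closed_compactin[OF K f(3) closedin_unit_supp[OF f(1,2) X]] by simp
qed

lemma Gamma_c_units_subgroup: "subgroup (Gamma_c_units \<G> \<O>) S"
proof (rule group.subgroupI[OF group_section])
  interpret S: group S by (rule group_section)
  show "Gamma_c_units \<G> \<O> \<subseteq> carrier S"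
    by (auto simp: Gamma_c_units_iff)
  have "continuous_map (unit_space \<G>) E \<one>\<^bsub>S\<^esub>"
    by (rule continuous_map_eq[OF continuous_zero]) (simp add: section_one)
  then have "\<one>\<^bsub>S\<^esub> \<in> Gamma_c_units \<G> \<O>"
    by (simp add: Gamma_c_units_iff supp_one)
  then show "Gamma_c_units \<G> \<O> \<noteq> {}" by blast
  fix f assume "f \<in> Gamma_c_units \<G> \<O>"
  then have f: "f \<in> carrier S" "continuous_map (unit_space \<G>) E f"
    "compactin (unit_space \<G>) (supp \<G> \<O> f)"
    by (simp_all add: Gamma_c_units_iff)
  have pf: "p (f x) = x" if "x \<in> X" for x
    using section_proj[OF f(1), of x] that by simp
  have "continuous_map (unit_space \<G>) E (\<lambda>x. \<ominus>\<^bsub>R (p (f x))\<^esub> f x)"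
    using continuous_map_compose[OF f(2) continuous_neg] by (simp add: o_def)
  then have "continuous_map (unit_space \<G>) E (inv\<^bsub>S\<^esub> f)"
    by (rule continuous_map_eq) (simp add: section_inv f pf)
  then show "inv\<^bsub>S\<^esub> f \<in> Gamma_c_units \<G> \<O>"
    using f by (intro Gamma_c_units_I[where K = "supp \<G> \<O> f"]) (simp_all add: supp_inv)
  fix g assume "g \<in> Gamma_c_units \<G> \<O>"
  then have g: "g \<in> carrier S" "continuous_map (unit_space \<G>) E g"
    "compactin (unit_space \<G>) (supp \<G> \<O> g)"
    by (simp_all add: Gamma_c_units_iff)
  have pg: "p (g x) = x" if "x \<in> X" for x
    using section_proj[OF g(1), of x] that by simp
  have "continuous_map (unit_space \<G>) E (\<lambda>x. f x \<oplus>\<^bsub>R (p (f x))\<^esub> g x)"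
    by (rule continuous_add[OF f(2) g(2)]) (simp add: pf pg)
  then have "continuous_map (unit_space \<G>) E (f \<otimes>\<^bsub>S\<^esub> g)"
    by (rule continuous_map_eq) (simp add: section_mult pf)
  then show "f \<otimes>\<^bsub>S\<^esub> g \<in> Gamma_c_units \<G> \<O>"
    using f(1) g(1) supp_mult[OF f(1) g(1)] compactin_Un[OF f(3) g(3)]
    by (intro Gamma_c_units_I[where K = "supp \<G> \<O> f \<union> supp \<G> \<O> g"]) simp_all
qed

text \<open>Finitely many compact open sets of units cover the support. Their union is still a
  bisection because \<open>s\<close> and \<open>r\<close> are the identity on units; for general
  arrows a union of bisections need not be one.\<close>

lemma Gamma_c_units_bisection_section:
  assumes "f \<in> Gamma_c_units \<G> \<O>"
  obtains K where "bisection_section K f" "K \<subseteq> X"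
proof -
  have f: "f \<in> carrier S" "continuous_map (unit_space \<G>) E f"
    "compactin (unit_space \<G>) (supp \<G> \<O> f)" "supp \<G> \<O> f \<subseteq> X"
    using assms by (simp_all add: Gamma_c_units_iff)
  let ?\<K> = "{K. openin (unit_space \<G>) K \<and> compactin (unit_space \<G>) K}"
  have "supp \<G> \<O> f \<subseteq> \<Union>?\<K>"
  proof
    fix x assume "x \<in> supp \<G> \<O> f"
    then have "x \<in> topspace (unit_space \<G>)" using f(4) by auto
    then show "x \<in> \<Union>?\<K>"
      using compact_open_unit_nbhd[OF openin_topspace] by blast
  qed
  then obtain \<F> where \<F>: "finite \<F>" "\<F> \<subseteq> ?\<K>" "supp \<G> \<O> f \<subseteq> \<Union>\<F>"
    using compactinD[OF f(3), of ?\<K>] by blast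
  have K: "compact_open_bisection \<G> (\<Union>\<F>)"
    using \<F> by (intro compact_open_bisection_units openin_Union compactin_Union) auto
  have KX: "\<Union>\<F> \<subseteq> X"
    using \<F>(2) openin_units_iff by blast
  have "continuous_map (subtopology T (\<Union>\<F>)) E f"
    by (rule continuous_map_from_subtopology_mono[OF f(2) KX])
  then show ?thesis
    using that[of "\<Union>\<F>"] f(1) K \<F>(3) KX by (simp add: bisection_section_def)
qed

text \<open>A compact open set of units is also closed in the Hausdorff unit space, so the section
  over \<open>U\<close> and the zero section over its complement glue to a continuous
  section.\<close>

lemma bisection_section_Gamma_c_units:
  assumes f: "bisection_section U f" and U: "U \<subseteq> X"
  shows "f \<in> Gamma_c_units \<G> \<O>"
proof -
  have fS: "f \<in> carrier S" and Uo: "openin T U" and Uc: "compactin (unit_space \<G>) U"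
    and fc: "continuous_map (subtopology T U) E f" and fU: "supp \<G> \<O> f \<subseteq> U"
    using f U by (auto simp: bisection_section_def compact_open_bisection_iff compactin_units_iff)
  have U': "openin (unit_space \<G>) U"
    using Uo U by (simp add: openin_units_iff)
  have "closedin (unit_space \<G>) U"
    by (rule compactin_imp_closedin[OF Hausdorff_units Uc])
  then have C: "openin (unit_space \<G>) (X - U)"
    unfolding closedin_def topspace_units by blast
  have zero: "zero x = f x" if "x \<in> X - U" for x
  proof -
    have "x \<notin> supp \<G> \<O> f" using that fU by blast
    then show ?thesis using that by (simp add: supp_iff)
  qed
  have "continuous_map (unit_space \<G>) E f"
  proof (rule continuous_map_locally)
    fix x assume x: "x \<in> topspace (unit_space \<G>)"
    have "continuous_map (subtopology (unit_space \<G>) U) E f"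
      using fc U by (simp add: subtopology_subtopology Int_absorb1)
    moreover have "continuous_map (subtopology (unit_space \<G>) (X - U)) E f"
      by (rule continuous_map_eq[OF continuous_map_from_subtopology[OF continuous_zero]])
        (rule zero, simp only: topspace_subtopology Int_iff)
    ultimately show "\<exists>V. openin (unit_space \<G>) V \<and> x \<in> V \<and> continuous_map (subtopology (unit_space \<G>) V) E f"
      using x U' C by (cases "x \<in> U") auto
  qed
  then show ?thesis
    by (rule Gamma_c_units_I[OF fS _ fU Uc])
qed

text \<open>Identifies the ring attached to Int(ker O) with the ring over the units once that
  interior is the unit space.\<close>

lemma Gamma_c_units_eq: "Gamma_c_units \<G> \<O> = Gamma_c_on \<G> \<O> X"
proof
  show "Gamma_c_units \<G> \<O> \<subseteq> Gamma_c_on \<G> \<O> X"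
  proof
    fix f assume "f \<in> Gamma_c_units \<G> \<O>"
    then obtain K where "bisection_section K f" "K \<subseteq> X"
      by (rule Gamma_c_units_bisection_section)
    then show "f \<in> Gamma_c_on \<G> \<O> X"
      by (rule bisection_section_Gamma_c_on)
  qed
  show "Gamma_c_on \<G> \<O> X \<subseteq> Gamma_c_units \<G> \<O>"
    unfolding Gamma_c_on_eq
    by (rule group.generate_subgroup_incl[OF group_section _ Gamma_c_units_subgroup])
      (use bisection_section_Gamma_c_units in blast)
qed

lemma Gamma_c_units_subset: "Gamma_c_units \<G> \<O> \<subseteq> Gamma_c \<G> \<O>"
proof
  fix f assume "f \<in> Gamma_c_units \<G> \<O>"
  then obtain K where "bisection_section K f" "K \<subseteq> X"
    by (rule Gamma_c_units_bisection_section)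
  then show "f \<in> Gamma_c \<G> \<O>"
    unfolding Gamma_c_def by (intro bisection_section_Gamma_c_on bisection_section_subset)
qed

text \<open>The only factorization ending in a unit is \<open>(\<gamma>, s \<gamma>)\<close>, and it
  leaves the action of \<gamma> visible. In the mirror case a unit acts, so the action disappears;
  comparing the two values gives the pointwise commutation condition.\<close>

lemma conv_unit_right:
  assumes fg: "f \<in> carrier S" "g \<in> carrier S" and g: "supp \<G> \<O> g \<subseteq> X" and \<gamma>: "\<gamma> \<in> A"
  shows "conv \<G> \<O> f g \<gamma> = f \<gamma> \<otimes>\<^bsub>R (r \<gamma>)\<^esub> \<alpha> \<gamma> (g (s \<gamma>))"
proof -
  have "conv \<G> \<O> f g \<gamma> = summand f g (\<gamma>, s \<gamma>)"
  proof (rule conv_eq_summand[OF fg \<gamma>])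
    show "(\<gamma>, s \<gamma>) \<in> factorizations \<gamma>"
      using \<gamma> by (simp add: factorizations_iff)
    fix q assume q: "q \<in> factorizations \<gamma>" "summand f g q \<noteq> zero (r \<gamma>)"
    obtain \<beta> \<rho> where [simp]: "q = (\<beta>, \<rho>)" by force
    have "\<rho> \<in> X" using q summand_nonzero[OF fg] g by auto
    then have "\<rho> = s \<beta>" "\<beta> \<in> A" "\<beta> \<cdot> \<rho> = \<gamma>" using q by (auto simp: factorizations_iff)
    then show "q = (\<gamma>, s \<gamma>)" by simp
  qed
  then show ?thesis by (simp add: summand_def)
qed

lemma conv_unit_left:
  assumes fg: "f \<in> carrier S" "g \<in> carrier S" and f: "supp \<G> \<O> f \<subseteq> X" and \<gamma>: "\<gamma> \<in> A"
  shows "conv \<G> \<O> f g \<gamma> = f (r \<gamma>) \<otimes>\<^bsub>R (r \<gamma>)\<^esub> g \<gamma>"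
proof -
  have "conv \<G> \<O> f g \<gamma> = summand f g (r \<gamma>, \<gamma>)"
  proof (rule conv_eq_summand[OF fg \<gamma>])
    show "(r \<gamma>, \<gamma>) \<in> factorizations \<gamma>"
      using \<gamma> by (simp add: factorizations_iff)
    fix q assume q: "q \<in> factorizations \<gamma>" "summand f g q \<noteq> zero (r \<gamma>)"
    obtain \<beta> \<rho> where [simp]: "q = (\<beta>, \<rho>)" by force
    have "\<beta> \<in> X" using q summand_nonzero[OF fg] f by auto
    then have "\<beta> = r \<rho>" "\<rho> \<in> A" "\<beta> \<cdot> \<rho> = \<gamma>" using q by (auto simp: factorizations_iff)
    then show "q = (r \<gamma>, \<gamma>)" by simp
  qed
  then show ?thesis
    using \<gamma> act_unit[OF rng_in_units[OF \<gamma>] section_mem[OF fg(2) \<gamma>]] by (simp add: summand_def)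
qed

lemma Gamma_c_units_conv:
  assumes "f \<in> Gamma_c_units \<G> \<O>" "g \<in> Gamma_c_units \<G> \<O>"
  shows "conv \<G> \<O> f g \<in> Gamma_c_units \<G> \<O>"
proof -
  have f: "f \<in> carrier S" "continuous_map (unit_space \<G>) E f"
    "compactin (unit_space \<G>) (supp \<G> \<O> f)" "supp \<G> \<O> f \<subseteq> X"
    and g: "g \<in> carrier S" "continuous_map (unit_space \<G>) E g" "supp \<G> \<O> g \<subseteq> X"
    using assms by (simp_all add: Gamma_c_units_iff)
  have pf: "p (f x) = x" and pg: "p (g x) = x" if "x \<in> X" for x
    using section_proj[OF f(1), of x] section_proj[OF g(1), of x] that by simp_all
  have "continuous_map (unit_space \<G>) E (\<lambda>x. f x \<otimes>\<^bsub>R (p (f x))\<^esub> g x)"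
    by (rule continuous_times[OF f(2) g(2)]) (simp add: pf pg)
  then have "continuous_map (unit_space \<G>) E (conv \<G> \<O> f g)"
    by (rule continuous_map_eq) (simp add: conv_unit_left[OF f(1) g(1) f(4)] pf)
  moreover have "supp \<G> \<O> (conv \<G> \<O> f g) \<subseteq> supp \<G> \<O> f"
  proof
    fix \<gamma> assume "\<gamma> \<in> supp \<G> \<O> (conv \<G> \<O> f g)"
    then obtain \<beta> \<rho> where "\<beta> \<in> supp \<G> \<O> f" "\<rho> \<in> supp \<G> \<O> g" "s \<beta> = r \<rho>" "\<gamma> = \<beta> \<cdot> \<rho>"
      by (rule conv_supp[OF f(1) g(1)])
    moreover from this have "\<beta> \<in> X" "\<rho> \<in> X" using f(4) g(3) by auto
    ultimately show "\<gamma> \<in> supp \<G> \<O> f"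
      using mult_src_right[of \<beta>] by simp
  qed
  ultimately show ?thesis
    by (intro Gamma_c_units_I[OF conv_closed[OF f(1) g(1)] _ _ f(3)])
qed

section \<open>Maximal commutative subrings\<close>

definition extend_by_zero :: "'g set \<Rightarrow> ('g \<Rightarrow> 'e) \<Rightarrow> 'g \<Rightarrow> 'e" where
  "extend_by_zero U f = (\<lambda>\<gamma>\<in>A. if \<gamma> \<in> U then f \<gamma> else zero (r \<gamma>))"

lemma extend_by_zero_bisection_section:
  assumes U: "compact_open_bisection \<G> U" and f: "continuous_map (subtopology T U) E f"
    "\<And>\<gamma>. \<gamma> \<in> U \<Longrightarrow> f \<gamma> \<in> carrier (R (r \<gamma>))"
  shows "bisection_section U (extend_by_zero U f)"
proof -
  have "extend_by_zero U f \<in> carrier S"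
    using f(2) ring.ring_simprules(2)[OF ring_stalk] by (simp add: section_carrier extend_by_zero_def)
  moreover have "continuous_map (subtopology T U) E (extend_by_zero U f)"
    by (rule continuous_map_eq[OF f(1)]) (simp add: extend_by_zero_def)
  moreover have "supp \<G> \<O> (extend_by_zero U f) \<subseteq> U"
    by (auto simp: supp_iff extend_by_zero_def split: if_splits)
  ultimately show ?thesis
    using U by (simp add: bisection_section_def)
qed

section \<open>Arrows acting trivially, and the two implications\<close>

lemma units_subset_ker: "X \<subseteq> ker_sheaf \<G> \<O>"
  using act_unit by (auto simp: ker_sheaf_def iso_bundle_def)

lemma ker_sheafD:
  assumes "\<gamma> \<in> ker_sheaf \<G> \<O>"
  shows "\<gamma> \<in> A" "r \<gamma> = s \<gamma>" "\<And>a. a \<in> carrier (R (s \<gamma>)) \<Longrightarrow> \<alpha> \<gamma> a = a"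
  using assms by (auto simp: ker_sheaf_def iso_bundle_def)

lemma act_mult:
  assumes "\<beta> \<in> A" "\<gamma> \<in> A" "s \<beta> = r \<gamma>" "e \<in> carrier (R (s \<gamma>))"
  shows "\<alpha> \<beta> (\<alpha> \<gamma> e) = \<alpha> (\<beta> \<cdot> \<gamma>) e"
proof -
  have "(\<beta>, \<gamma>) \<in> composable \<G>" "(\<gamma>, e) \<in> action_domain \<G> \<O>"
    using assms by (auto simp: composable_iff action_domain_def carrier_stalk)
  then show ?thesis
    using gsheaf unfolding is_gsheaf_def by blast
qed

lemma ker_sheaf_mult:
  assumes "\<beta> \<in> ker_sheaf \<G> \<O>" "\<gamma> \<in> ker_sheaf \<G> \<O>" "s \<beta> = s \<gamma>"
  shows "\<beta> \<cdot> \<gamma> \<in> ker_sheaf \<G> \<O>"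
proof -
  note b = ker_sheafD[OF assms(1)] and c = ker_sheafD[OF assms(2)]
  have "\<alpha> (\<beta> \<cdot> \<gamma>) a = a" if "a \<in> carrier (R (s \<gamma>))" for a
    using act_mult[of \<beta> \<gamma> a] b c that assms(3) by simp
  then show ?thesis
    using b c assms(3) by (simp add: ker_sheaf_def iso_bundle_def)
qed

lemma units_subset_int_ker: "X \<subseteq> int_ker \<G> \<O>"
  using units_subset_ker openin_units by (rule interior_of_maximal)

text \<open>For arrows of \<open>W\<close> a term for \<open>(\<beta>, \<rho>)\<close> equals the
  term for \<open>(\<rho>, \<beta>)\<close> by commutativity of the stalk, and both pairs have the
  same product. Exchanging factors thus matches the two convolution sums. The lemma is applied to
  the bicommutant and to the unit space.\<close>

lemma comm_conv_subring_supp: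
  assumes comm: "\<And>x. x \<in> X \<Longrightarrow> cring (R x)" and W: "W \<subseteq> ker_sheaf \<G> \<O>"
    and mult: "\<And>a b. \<lbrakk>a \<in> W; b \<in> W; s a = s b\<rbrakk> \<Longrightarrow> a \<cdot> b \<in> W"
    and commute: "\<And>a b. \<lbrakk>a \<in> W; b \<in> W; s a = s b\<rbrakk> \<Longrightarrow> a \<cdot> b = b \<cdot> a"
  shows "comm_conv_subring \<G> \<O> {f \<in> Gamma_c \<G> \<O>. supp \<G> \<O> f \<subseteq> W}"
proof -
  interpret S: group S by (rule group_section)
  let ?D = "{f \<in> Gamma_c \<G> \<O>. supp \<G> \<O> f \<subseteq> W}"
  have \<Gamma>: "subgroup (Gamma_c \<G> \<O>) S"
    unfolding Gamma_c_def by (rule Gamma_c_on_subgroup)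
  have carr: "f \<in> carrier S" if "f \<in> ?D" for f
    using that subgroup.subset[OF \<Gamma>] by blast
  have "subgroup ?D S"
  proof (rule S.subgroupI)
    show "?D \<subseteq> carrier S" using carr by blast
    have "\<one>\<^bsub>S\<^esub> \<in> ?D" using subgroup.one_closed[OF \<Gamma>] by (simp add: supp_one)
    then show "?D \<noteq> {}" by blast
    show "inv\<^bsub>S\<^esub> f \<in> ?D" if "f \<in> ?D" for f
      using that carr[OF that] subgroup.m_inv_closed[OF \<Gamma>] by (simp add: supp_inv)
    show "f \<otimes>\<^bsub>S\<^esub> g \<in> ?D" if "f \<in> ?D" "g \<in> ?D" for f g
      using that supp_mult[OF that[THEN carr]] subgroup.m_closed[OF \<Gamma>] by blast
  qed
  moreover have "conv \<G> \<O> f g \<in> ?D" if fg: "f \<in> ?D" "g \<in> ?D" for f g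
  proof -
    have "supp \<G> \<O> (conv \<G> \<O> f g) \<subseteq> W"
    proof
      fix \<gamma> assume "\<gamma> \<in> supp \<G> \<O> (conv \<G> \<O> f g)"
      then obtain \<beta> \<rho> where q: "\<beta> \<in> supp \<G> \<O> f" "\<rho> \<in> supp \<G> \<O> g" "s \<beta> = r \<rho>" "\<gamma> = \<beta> \<cdot> \<rho>"
        by (rule conv_supp[OF fg[THEN carr]])
      then have "\<beta> \<in> W" "\<rho> \<in> W" using fg by auto
      then show "\<gamma> \<in> W"
        using mult q(3,4) ker_sheafD(2)[of \<rho>] W by auto
    qed
    then show ?thesis using fg Gamma_c_conv_closed by blast
  qed
  moreover have "conv \<G> \<O> f g = conv \<G> \<O> g f" if fg: "f \<in> ?D" "g \<in> ?D" for f g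
  proof (rule section_ext)
    show "conv \<G> \<O> f g \<in> carrier S" "conv \<G> \<O> g f \<in> carrier S"
      using carr fg conv_closed by blast+
    fix \<gamma> assume \<gamma>: "\<gamma> \<in> A"
    interpret cring "R (r \<gamma>)" by (rule comm) (simp add: \<gamma>)
    let ?N = "\<lambda>f g. {q \<in> factorizations \<gamma>. summand f g q \<noteq> zero (r \<gamma>)}"
    \<comment> \<open>Quantified over the two sections again, so that it yields both inclusions
      between the index sets of the two sums.\<close>
    have swap: "prod.swap q \<in> factorizations \<gamma> \<and> summand g f (prod.swap q) = summand f g q"
      if f: "f \<in> ?D" and g: "g \<in> ?D" and q: "q \<in> ?N f g" for f g q
    proof -
      obtain \<beta> \<rho> where [simp]: "q = (\<beta>, \<rho>)" by force
      have fact: "(\<beta>, \<rho>) \<in> factorizations \<gamma>" "summand f g (\<beta>, \<rho>) \<noteq> zero (r \<gamma>)"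
        using q by auto
      have *: "\<beta> \<in> W" "\<rho> \<in> W"
        using summand_nonzero[OF carr[OF f] carr[OF g] fact] f g by auto
      note b = ker_sheafD[OF subsetD[OF W *(1)]] and c = ker_sheafD[OF subsetD[OF W *(2)]]
      have sr: "s \<beta> = r \<rho>" "\<beta> \<cdot> \<rho> = \<gamma>" using fact by (auto simp: factorizations_iff)
      have r\<gamma>: "r \<beta> = r \<gamma>" using fact by (rule_tac factorizations_rng)
      have "\<rho> \<cdot> \<beta> = \<gamma>" using commute[OF *] sr c(2) by simp
      moreover have "f \<beta> \<in> carrier (R (r \<gamma>))" "g \<rho> \<in> carrier (R (r \<gamma>))"
        using section_mem[OF carr[OF f] b(1)] section_mem[OF carr[OF g] c(1)] r\<gamma> sr b(2) by simp_all
      moreover from this have "g \<rho> \<otimes>\<^bsub>R (r \<gamma>)\<^esub> f \<beta> = f \<beta> \<otimes>\<^bsub>R (r \<gamma>)\<^esub> g \<rho>"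
        by (intro m_comm)
      ultimately show ?thesis
        using b c sr r\<gamma> by (simp add: factorizations_iff summand_def)
    qed
    have N: "?N g f = prod.swap ` ?N f g"
    proof (intro equalityI subsetI)
      fix q assume q: "q \<in> ?N g f"
      then have "prod.swap q \<in> ?N f g" using swap[OF fg(2,1) q] by auto
      then show "q \<in> prod.swap ` ?N f g" by (intro image_eqI[of _ _ "prod.swap q"]) (rule swap_swap[symmetric])
    next
      fix q assume "q \<in> prod.swap ` ?N f g"
      then obtain q' where "q' \<in> ?N f g" "q = prod.swap q'" by blast
      then show "q \<in> ?N g f" using swap[OF fg, of q'] by auto
    qed
    have "conv \<G> \<O> g f \<gamma> = finsum (R (r \<gamma>)) (summand g f) (prod.swap ` ?N f g)"
      unfolding conv_eq[OF fg(2,1)[THEN carr] \<gamma>] N ..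
    also have "\<dots> = finsum (R (r \<gamma>)) (\<lambda>q. summand g f (prod.swap q)) (?N f g)"
      by (rule finsum_reindex)
        (use summand_closed[OF fg[THEN carr]] swap[OF fg] in \<open>auto simp: inj_on_def\<close>)
    also have "\<dots> = finsum (R (r \<gamma>)) (summand f g) (?N f g)"
      by (rule finsum_cong') (use summand_closed[OF fg[THEN carr]] swap[OF fg] in auto)
    finally show "conv \<G> \<O> f g \<gamma> = conv \<G> \<O> g f \<gamma>"
      unfolding conv_eq[OF fg[THEN carr] \<gamma>] by simp
  qed
  ultimately show ?thesis
    unfolding comm_conv_subring_def conv_subring_def by blast
qed

text \<open>The argument is direct: for an arrow \<gamma> in the interior, maximality puts the
  indicator of a small bisection around \<gamma> into the ring over the units. Its support contains
  \<gamma>, which is therefore a unit.\<close>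

lemma int_ker_eq_units:
  assumes comm: "\<And>x. x \<in> X \<Longrightarrow> cring (R x)"
    and max: "maximal_comm_subring \<G> \<O> (Gamma_c_units \<G> \<O>)"
  shows "int_ker \<G> \<O> = X"
proof
  show "X \<subseteq> int_ker \<G> \<O>" by (rule units_subset_int_ker)
  show "int_ker \<G> \<O> \<subseteq> X"
  proof
    fix \<gamma> assume "\<gamma> \<in> int_ker \<G> \<O>"
    then obtain U where U: "compact_open_bisection \<G> U" "\<gamma> \<in> U" "U \<subseteq> int_ker \<G> \<O>"
      using compact_open_bisection_nbhd[OF openin_interior_of] by metis
    then have inj: "inj_on s U"
      by (simp add: compact_open_bisection_def bisection_def)
    have Uker: "U \<subseteq> ker_sheaf \<G> \<O>"
      using U(3) interior_of_subset by (rule order_trans)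
    \<comment> \<open>The double centralizer, taken separately over each unit: \<open>k\<close> runs
      over the arrows of ker O that commute with the arrow of \<open>U\<close> there, and
      \<open>h\<close> must commute with all such \<open>k\<close>. Over a unit that
      \<open>U\<close> misses, the condition on \<open>k\<close> is void and \<open>W\<close> is the
      centre.\<close>
    define W where "W = {h \<in> ker_sheaf \<G> \<O>. \<forall>k\<in>ker_sheaf \<G> \<O>. s k = s h \<longrightarrow>
      (\<forall>u\<in>U. s u = s h \<longrightarrow> u \<cdot> k = k \<cdot> u) \<longrightarrow> h \<cdot> k = k \<cdot> h}"
    have W: "W \<subseteq> ker_sheaf \<G> \<O>" by (auto simp: W_def)
    have W_commute: "h \<cdot> k = k \<cdot> h"
      if "h \<in> W" "k \<in> ker_sheaf \<G> \<O>" "s k = s h" "\<And>u. \<lbrakk>u \<in> U; s u = s h\<rbrakk> \<Longrightarrow> u \<cdot> k = k \<cdot> u" for h k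
      using that unfolding W_def by blast
    \<comment> \<open>For \<open>h\<close> in \<open>U\<close>, the condition on \<open>k\<close>
      can be instantiated with \<open>h\<close> itself.\<close>
    have UW: "U \<subseteq> W" using Uker by (auto simp: W_def)
    have XW: "X \<subseteq> W"
    proof
      fix x assume x: "x \<in> X"
      have "x \<cdot> k = k \<cdot> x" if "k \<in> ker_sheaf \<G> \<O>" "s k = s x" for k
        using ker_sheafD(1,2)[OF that(1)] that(2) x mult_src_right[of k] rng_mult_left[of k] by simp
      then show "x \<in> W" using x units_subset_ker by (auto simp: W_def)
    qed
    have commute: "a \<cdot> b = b \<cdot> a" if "a \<in> W" "b \<in> W" "s a = s b" for a b
    proof -
      \<comment> \<open>\<open>W\<close> centralizes \<open>U\<close>: since \<open>u\<close> is the
        only arrow of \<open>U\<close> over \<open>s b\<close>, it is an admissible test arrow for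
        \<open>b\<close>. Consequently \<open>b\<close> is an admissible test arrow for
        \<open>a\<close>.\<close>
      have "u \<cdot> b = b \<cdot> u" if u: "u \<in> U" "s u = s b" for u
      proof -
        have "u' = u" if "u' \<in> U" "s u' = s b" for u'
          using inj_onD[OF inj, of u' u] that u by simp
        then show ?thesis
          using W_commute[OF \<open>b \<in> W\<close> subsetD[OF Uker u(1)] u(2)] by simp
      qed
      then show ?thesis using W_commute[OF that(1), of b] that W by auto
    qed
    \<comment> \<open>A test arrow \<open>k\<close> for \<open>a \<cdot> b\<close> is also one for
      \<open>a\<close> and for \<open>b\<close>, as all sources agree. It can then be moved past the
      factors one by one.\<close>
    have mult: "a \<cdot> b \<in> W" if ab: "a \<in> W" "b \<in> W" "s a = s b" for a b
    proof -
      have abk: "a \<in> ker_sheaf \<G> \<O>" "b \<in> ker_sheaf \<G> \<O>" using ab W by auto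
      note a = ker_sheafD(1,2)[OF abk(1)] and b = ker_sheafD(1,2)[OF abk(2)]
      have sab: "s (a \<cdot> b) = s b" using a b ab(3) by simp
      have "(a \<cdot> b) \<cdot> k = k \<cdot> (a \<cdot> b)"
        if k: "k \<in> ker_sheaf \<G> \<O>" "s k = s b" "\<forall>u\<in>U. s u = s b \<longrightarrow> u \<cdot> k = k \<cdot> u" for k
      proof -
        note kk = ker_sheafD(1,2)[OF k(1)]
        have ak: "a \<cdot> k = k \<cdot> a"
          using ab(3) k(2,3) by (intro W_commute[OF ab(1) k(1)]) metis+
        have bk: "b \<cdot> k = k \<cdot> b"
          using k(2,3) by (intro W_commute[OF ab(2) k(1)]) metis+
        have sr: "s a = r b" "s b = r k" "s a = r k" "s k = r a" "s k = r b"
          using a(2) b(2) kk(2) k(2) ab(3) by simp_all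
        have "(a \<cdot> b) \<cdot> k = a \<cdot> (k \<cdot> b)"
          using mult_assoc[OF a(1) b(1) kk(1) sr(1,2)] bk by metis
        also have "\<dots> = (k \<cdot> a) \<cdot> b"
          using mult_assoc[OF a(1) kk(1) b(1) sr(3,5)] ak by metis
        also have "\<dots> = k \<cdot> (a \<cdot> b)"
          by (rule mult_assoc[OF kk(1) a(1) b(1) sr(4,1)])
        finally show ?thesis .
      qed
      then show ?thesis
        using ker_sheaf_mult[OF abk ab(3)] sab unfolding W_def by simp
    qed
    let ?D = "{f \<in> Gamma_c \<G> \<O>. supp \<G> \<O> f \<subseteq> W}"
    have "comm_conv_subring \<G> \<O> ?D"
      by (rule comm_conv_subring_supp[OF comm W mult commute])
    moreover have "Gamma_c_units \<G> \<O> \<subseteq> ?D"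
    proof
      fix f assume "f \<in> Gamma_c_units \<G> \<O>"
      then show "f \<in> ?D"
        using Gamma_c_units_subset Gamma_c_units_iff[of f] XW by blast
    qed
    ultimately have D: "?D = Gamma_c_units \<G> \<O>"
      using max unfolding maximal_comm_subring_def by blast
    let ?f = "extend_by_zero U (\<lambda>\<gamma>. \<one>\<^bsub>R (r \<gamma>)\<^esub>)"
    have UA: "U \<subseteq> A" using U(1) by (simp add: compact_open_bisection_def bisection_def)
    have "continuous_map (subtopology T U) E (\<lambda>\<gamma>. \<one>\<^bsub>R (r \<gamma>)\<^esub>)"
      using continuous_map_compose[OF continuous_map_from_subtopology[OF continuous_rng] continuous_one]
      by (simp add: o_def)
    moreover have "\<one>\<^bsub>R (r \<gamma>)\<^esub> \<in> carrier (R (r \<gamma>))" if "\<gamma> \<in> U" for \<gamma>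
      using that UA ring.ring_simprules(6)[OF ring_stalk] by auto
    ultimately have f: "bisection_section U ?f"
      by (intro extend_by_zero_bisection_section U(1))
    then have "?f \<in> ?D"
      using bisection_section_Gamma_c_on[OF f bisection_section_subset[OF f]] UW
      by (auto simp: Gamma_c_def bisection_section_def)
    then have "supp \<G> \<O> ?f \<subseteq> X"
      using D Gamma_c_units_iff by blast
    \<comment> \<open>The stalks are nontrivial, so the indicator vanishes nowhere on
      \<open>U\<close>.\<close>
    moreover have "\<gamma> \<in> supp \<G> \<O> ?f"
      using U(2) UA one_neq_zero[OF rng_in_units, of \<gamma>] by (auto simp: supp_iff extend_by_zero_def)
    ultimately show "\<gamma> \<in> X" by blast
  qed
qed

text \<open>Two kinds of test section are used: one equal to 1 at \<open>r \<gamma>\<close> and 0 at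
  \<open>s \<gamma>\<close> excludes distinct endpoints, and one with arbitrary value at
  \<open>s \<gamma>\<close> then shows that \<gamma> acts trivially.\<close>

lemma supp_centralizer_subset_ker:
  assumes dom: "\<And>x. x \<in> X \<Longrightarrow> domain (R x)" and f: "f \<in> carrier S"
    and cent: "\<And>g. g \<in> Gamma_c_units \<G> \<O> \<Longrightarrow> conv \<G> \<O> f g = conv \<G> \<O> g f"
  shows "supp \<G> \<O> f \<subseteq> ker_sheaf \<G> \<O>"
proof
  fix \<gamma> assume "\<gamma> \<in> supp \<G> \<O> f"
  then have \<gamma>: "\<gamma> \<in> A" and f\<gamma>: "f \<gamma> \<noteq> zero (r \<gamma>)" by (auto simp: supp_iff)
  interpret domain "R (r \<gamma>)" by (rule dom) (simp add: \<gamma>)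
  have act: "\<alpha> \<gamma> (g (s \<gamma>)) = g (r \<gamma>)" if g: "g \<in> Gamma_c_units \<G> \<O>" for g
  proof -
    have gS: "g \<in> carrier S" and gX: "supp \<G> \<O> g \<subseteq> X"
      using g Gamma_c_units_iff by blast+
    have gs: "g (s \<gamma>) \<in> carrier (R (s \<gamma>))" and gr: "g (r \<gamma>) \<in> carrier (R (r \<gamma>))"
      using section_mem[OF gS, of "s \<gamma>"] section_mem[OF gS, of "r \<gamma>"] \<gamma> by simp_all
    have "f \<gamma> \<otimes>\<^bsub>R (r \<gamma>)\<^esub> \<alpha> \<gamma> (g (s \<gamma>)) = g (r \<gamma>) \<otimes>\<^bsub>R (r \<gamma>)\<^esub> f \<gamma>"
      using conv_unit_right[OF f gS gX \<gamma>] conv_unit_left[OF gS f gX \<gamma>] cent[OF g] by simp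
    then have "f \<gamma> \<otimes>\<^bsub>R (r \<gamma>)\<^esub> \<alpha> \<gamma> (g (s \<gamma>)) = f \<gamma> \<otimes>\<^bsub>R (r \<gamma>)\<^esub> g (r \<gamma>)"
      using gr section_mem[OF f \<gamma>] by (simp add: m_comm)
    then show ?thesis
      using m_lcancel[OF f\<gamma> section_mem[OF f \<gamma>] act_closed[OF \<gamma> gs] gr] by blast
  qed
  \<comment> \<open>The set \<open>V\<close> permits prescribing the value at \<open>p e\<close>
    while forcing zero at a second unit separated from it.\<close>
  have sect: "\<exists>g\<in>Gamma_c_units \<G> \<O>. g (p e) = e \<and> (\<forall>y\<in>X. y \<notin> V \<longrightarrow> g y = zero y)"
    if e: "e \<in> topspace E" and V: "openin (unit_space \<G>) V" "p e \<in> V" for e V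
  proof -
    obtain K \<sigma> where K: "openin (unit_space \<G>) K" "compactin (unit_space \<G>) K" "p e \<in> K"
      "continuous_map (subtopology (unit_space \<G>) K) E \<sigma>" "\<And>x. x \<in> K \<Longrightarrow> \<sigma> x \<in> carrier (R x)" "\<sigma> (p e) = e"
      using local_section[OF e] by metis
    obtain L where L: "openin (unit_space \<G>) L" "compactin (unit_space \<G>) L" "p e \<in> L" "L \<subseteq> K \<inter> V"
      using compact_open_unit_nbhd[OF openin_Int[OF K(1) V(1)]] K(3) V(2) by blast
    have LX: "L \<subseteq> X" using L(1) openin_units_iff by blast
    have "continuous_map (subtopology (unit_space \<G>) L) E \<sigma>"
      using L(4) by (intro continuous_map_from_subtopology_mono[OF K(4)]) blast
    then have "continuous_map (subtopology T L) E \<sigma>"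
      using LX by (simp add: subtopology_subtopology Int_absorb1)
    moreover have "\<sigma> y \<in> carrier (R (r y))" if "y \<in> L" for y
    proof -
      have "y \<in> K" "y \<in> X" using L(4) LX that by auto
      then show ?thesis using K(5)[of y] by simp
    qed
    ultimately have "bisection_section L (extend_by_zero L \<sigma>)"
      by (intro extend_by_zero_bisection_section compact_open_bisection_units L(1,2))
    then have "extend_by_zero L \<sigma> \<in> Gamma_c_units \<G> \<O>"
      using LX by (rule bisection_section_Gamma_c_units)
    moreover have "extend_by_zero L \<sigma> (p e) = e"
      using L(3) LX K(6) by (auto simp: extend_by_zero_def)
    moreover have "\<forall>y\<in>X. y \<notin> V \<longrightarrow> extend_by_zero L \<sigma> y = zero y"
      using L(4) by (auto simp: extend_by_zero_def)
    ultimately show ?thesis by blast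
  qed
  have iso: "s \<gamma> = r \<gamma>"
  proof (rule ccontr)
    assume neq: "s \<gamma> \<noteq> r \<gamma>"
    have "r \<gamma> \<in> topspace (unit_space \<G>)" "s \<gamma> \<in> topspace (unit_space \<G>)"
      unfolding topspace_units using \<gamma> by simp_all
    then obtain V V' where V: "openin (unit_space \<G>) V" "openin (unit_space \<G>) V'"
      "r \<gamma> \<in> V" "s \<gamma> \<in> V'" "disjnt V V'"
      using Hausdorff_units neq unfolding Hausdorff_space_def by metis
    let ?e = "\<one>\<^bsub>R (r \<gamma>)\<^esub>"
    have e: "?e \<in> topspace E" "p ?e = r \<gamma>"
      using stalk_topspace stalk_proj \<gamma> one_closed rng_in_units by blast+
    obtain g where g: "g \<in> Gamma_c_units \<G> \<O>" "g (r \<gamma>) = ?e" "\<forall>y\<in>X. y \<notin> V \<longrightarrow> g y = zero y"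
      using sect[OF e(1) V(1)] V(3) unfolding e(2) by blast
    \<comment> \<open>The action sends zero to zero, so \<open>act\<close> would force
      \<open>g\<close> to vanish at \<open>r \<gamma>\<close>, where its value is one.\<close>
    have "g (s \<gamma>) = zero (s \<gamma>)"
      using g(3) V(4,5) \<gamma> by (auto simp: disjnt_iff)
    then show False
      using act[OF g(1)] act_zero[OF \<gamma>] g(2) one_neq_zero[OF rng_in_units[OF \<gamma>]] by simp
  qed
  moreover have "\<alpha> \<gamma> a = a" if a: "a \<in> carrier (R (s \<gamma>))" for a
  proof -
    have e: "a \<in> topspace E" "p a = s \<gamma>"
      using stalk_topspace stalk_proj \<gamma> a src_in_units by blast+
    have "openin (unit_space \<G>) X"
      by (simp add: openin_units_iff openin_units)
    then obtain g where "g \<in> Gamma_c_units \<G> \<O>" "g (s \<gamma>) = a"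
      using sect[OF e(1)] \<gamma> unfolding e(2) by (meson src_in_units)
    then show ?thesis
      using act[of g] iso by simp
  qed
  ultimately show "\<gamma> \<in> ker_sheaf \<G> \<O>"
    using \<gamma> by (simp add: ker_sheaf_def iso_bundle_def)
qed

text \<open>Composable units are equal, so the unit space qualifies as \<open>W\<close> in
  \<open>comm_conv_subring_supp\<close>. Only commutativity is inherited from that ring of sections;
  closure is proved by continuity over the unit space.\<close>

lemma Gamma_c_units_comm_conv_subring:
  assumes comm: "\<And>x. x \<in> X \<Longrightarrow> cring (R x)"
  shows "comm_conv_subring \<G> \<O> (Gamma_c_units \<G> \<O>)"
proof -
  have "conv \<G> \<O> f g = conv \<G> \<O> g f" if fg: "f \<in> Gamma_c_units \<G> \<O>" "g \<in> Gamma_c_units \<G> \<O>" for f g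
  proof -
    have "comm_conv_subring \<G> \<O> {f \<in> Gamma_c \<G> \<O>. supp \<G> \<O> f \<subseteq> X}"
    proof (rule comm_conv_subring_supp[OF comm units_subset_ker])
      fix a b assume "a \<in> X" "b \<in> X" "s a = s b"
      then have "a = b" "a \<cdot> b = b" using rng_mult_left[of b] by auto
      then show "a \<cdot> b \<in> X" "a \<cdot> b = b \<cdot> a" using \<open>b \<in> X\<close> by simp_all
    qed
    moreover have "h \<in> {f \<in> Gamma_c \<G> \<O>. supp \<G> \<O> f \<subseteq> X}" if "h \<in> Gamma_c_units \<G> \<O>" for h
      using that Gamma_c_units_subset Gamma_c_units_iff[of h] by blast
    ultimately show ?thesis
      using fg unfolding comm_conv_subring_def by blast
  qed
  then show ?thesis
    unfolding comm_conv_subring_def conv_subring_def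
    using Gamma_c_units_subset Gamma_c_units_subgroup Gamma_c_units_conv by blast
qed

lemma maximal_comm_subring_units:
  assumes dom: "\<And>x. x \<in> X \<Longrightarrow> domain (R x)"
    and \<Gamma>: "Gamma_c_on \<G> \<O> (int_ker \<G> \<O>) = {f \<in> Gamma_c \<G> \<O>. supp \<G> \<O> f \<subseteq> ker_sheaf \<G> \<O>}"
    and int: "int_ker \<G> \<O> = X"
  shows "maximal_comm_subring \<G> \<O> (Gamma_c_units \<G> \<O>)"
  unfolding maximal_comm_subring_def
proof (intro conjI allI impI)
  show "comm_conv_subring \<G> \<O> (Gamma_c_units \<G> \<O>)"
    using dom domain.axioms(1) by (intro Gamma_c_units_comm_conv_subring) blast
  fix B assume B: "comm_conv_subring \<G> \<O> B" "Gamma_c_units \<G> \<O> \<subseteq> B"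
  have "f \<in> Gamma_c_units \<G> \<O>" if f: "f \<in> B" for f
  proof -
    have f\<Gamma>: "f \<in> Gamma_c \<G> \<O>"
      using B(1) f unfolding comm_conv_subring_def conv_subring_def by blast
    have "supp \<G> \<O> f \<subseteq> ker_sheaf \<G> \<O>"
    proof (rule supp_centralizer_subset_ker[OF dom])
      show "f \<in> carrier S" using f\<Gamma> Gamma_c_on_carrier unfolding Gamma_c_def by blast
      show "conv \<G> \<O> f g = conv \<G> \<O> g f" if "g \<in> Gamma_c_units \<G> \<O>" for g
        using B f that unfolding comm_conv_subring_def by blast
    qed
    \<comment> \<open>A support inside \<open>ker_sheaf\<close> does not by itself give a
      decomposition over bisections in the interior. The hypothesis \<open>\<Gamma>\<close> supplies
      one, and the interior is \<open>X\<close>.\<close>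
    then have "f \<in> Gamma_c_on \<G> \<O> X"
      using \<Gamma> f\<Gamma> int by simp
    then show ?thesis by (simp add: Gamma_c_units_eq)
  qed
  then show "B = Gamma_c_units \<G> \<O>" using B(2) by blast
qed

end

theorem proposition4p13:
  fixes \<G> :: "'g top_groupoid" and \<O> :: "('g, 'e) ring_gsheaf"
  assumes "ample_groupoid \<G>" and "sheaf_of_comm_rings \<G> \<O>"
  shows "(maximal_comm_subring \<G> \<O> (Gamma_c_units \<G> \<O>) \<longrightarrow> int_ker \<G> \<O> = units \<G>) \<and>
    (sheaf_of_domains \<G> \<O> \<and>
     Gamma_c_on \<G> \<O> (int_ker \<G> \<O>) = {f \<in> Gamma_c \<G> \<O>. supp \<G> \<O> f \<subseteq> ker_sheaf \<G> \<O>} \<longrightarrow>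
     int_ker \<G> \<O> = units \<G> \<longrightarrow> maximal_comm_subring \<G> \<O> (Gamma_c_units \<G> \<O>))"
proof -
  interpret ample_sheaf \<G> \<O>
    using assms by unfold_locales (simp_all add: sheaf_of_comm_rings_def)
  have "cring (stalk \<O> x)" if "x \<in> units \<G>" for x
    using assms(2) that by (simp add: sheaf_of_comm_rings_def)
  then show ?thesis
    using int_ker_eq_units maximal_comm_subring_units unfolding sheaf_of_domains_def by blast
qed

end
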